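(* There exists a recursive coloring function $c:\mathbb{N}\rightarrow \{0,1\}^3$ such that no infinite $\Pi^0_3$ set $A\subseteq\mathbb{N}$ is a solution to $c$ for Hindman's theorem, i.e. for every infinite $\Pi^0_3$ set $A$, the set $FS(A)$ is not monochromatic under $c$.
   Context: For a set $H\subseteq\mathbb{N}$, $FS(H)=\{\sum_{x\in F}x : F\subseteq H,\ F \text{ finite and nonempty}\}$. A set $H$ is a solution to a coloring $c$ for Hindman's theorem if $H$ is infinite and $FS(H)$ is monochromatic under $c$. *)

theory Defs
  imports Main
begin

text \<open>Codes of (partial) mu-recursive functions, Kleene style.
  Arguments are passed as a list; Id i projects the i-th argument,
  Pr recurses on the first argument, Mn minimises over the first argument.\<close>

datatype recf = Z | S | Id nat | Cn recf "recf list" | Pr recf recf | Mn recf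

inductive rec_eval :: "recf \<Rightarrow> nat list \<Rightarrow> nat \<Rightarrow> bool" where
  rZ: "rec_eval Z xs 0"
| rS: "rec_eval S (x # xs) (Suc x)"
| rId: "i < length xs \<Longrightarrow> rec_eval (Id i) xs (xs ! i)"
| rCn: "list_all2 (\<lambda>g y. rec_eval g xs y) gs ys \<Longrightarrow> rec_eval f ys y \<Longrightarrow> rec_eval (Cn f gs) xs y"
| rPr0: "rec_eval f xs y \<Longrightarrow> rec_eval (Pr f g) (0 # xs) y"
| rPrS: "rec_eval (Pr f g) (n # xs) y \<Longrightarrow> rec_eval g (n # y # xs) z
          \<Longrightarrow> rec_eval (Pr f g) (Suc n # xs) z"
| rMn: "rec_eval f (n # xs) 0 \<Longrightarrow> (\<forall>m<n. \<exists>v. rec_eval f (m # xs) v \<and> 0 < v)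
          \<Longrightarrow> rec_eval (Mn f) xs n"

definition recursive1 :: "(nat \<Rightarrow> nat) \<Rightarrow> bool" where
  "recursive1 f \<longleftrightarrow> (\<exists>p. \<forall>n. rec_eval p [n] (f n))"

definition recursive_rel4 :: "(nat \<Rightarrow> nat \<Rightarrow> nat \<Rightarrow> nat \<Rightarrow> bool) \<Rightarrow> bool" where
  "recursive_rel4 R \<longleftrightarrow>
     (\<exists>p. \<forall>a b c d. rec_eval p [a, b, c, d] (if R a b c d then 1 else 0))"

definition Pi03 :: "nat set \<Rightarrow> bool" where
  "Pi03 A \<longleftrightarrow> (\<exists>R. recursive_rel4 R \<and> (\<forall>n. n \<in> A \<longleftrightarrow> (\<forall>x. \<exists>y. \<forall>z. R n x y z)))"

definition FS :: "nat set \<Rightarrow> nat set" where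
  "FS H = {\<Sum>F | F. F \<subseteq> H \<and> finite F \<and> F \<noteq> {}}"

definition hindman_solution :: "(nat \<Rightarrow> nat) \<Rightarrow> nat set \<Rightarrow> bool" where
  "hindman_solution c H \<longleftrightarrow> infinite H \<and> (\<exists>k. \<forall>x\<in>FS H. c x = k)"

end

theory Submission
  imports Defs "HOL-Library.Nat_Bijection" "HOL-Library.Discrete_Functions" "HOL-Library.Infinite_Set"
begin

text \<open>
  One bit of colour suffices. Write \<open>x\<close> in binary and put \<open>c(x) = \<Sum> T\<^sub>t(x mod 2^t)\<close> modulo 2, the sum
  running over the set bits \<open>t\<close> of \<open>x\<close>, where \<open>T\<^sub>t(y)\<close> is a quadratic form in the bits of \<open>y\<close> below its top
  bit \<open>a\<close>, with coefficients \<open>D t a p' p \<in> {0, 1}\<close>.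

  Let \<open>A\<close> be a solution of colour \<open>\<gamma>\<close>, let \<open>m, m', m'', k\<close> be sums of disjoint finite subsets of \<open>A\<close> whose
  binary supports are stacked in this order, and let \<open>\<tau>\<close> be the lowest bit of \<open>k\<close>. Add up \<open>c(x) + c(x + k)\<close>
  over the cube \<open>x \<in> {0, m} + {0, m'} + {0, m''}\<close>. A second difference of a quadratic form modulo 2 does not
  depend on the base point, so the contributions of all bits of \<open>k\<close> above \<open>\<tau>\<close> cancel. What is left is a
  relation between \<open>\<gamma>\<close>, the values of \<open>T\<^sub>\<tau>\<close> at \<open>m\<close>, \<open>m'\<close>, \<open>m + m'\<close> and the sum of \<open>D \<tau> a q' q\<close> over the bits
  \<open>q'\<close> of \<open>m'\<close> and \<open>q\<close> of \<open>m\<close>, where \<open>a\<close> is the top bit of \<open>m''\<close>. It can be violated by the choice of the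
  single coefficient \<open>D \<tau> a p' p\<close>, with \<open>p\<close> and \<open>p'\<close> the top bits of \<open>m\<close> and \<open>m'\<close>, all other coefficients that
  occur being earlier in the lexicographic order.

  So \<open>D t a p' p\<close> is spent on one pair \<open>(m, m')\<close>, guessed from \<open>p, p', a, t\<close>. Membership in a \<open>\<Pi>\<^sup>0\<^sub>3\<close> set is a
  threefold limit of computable guesses, and the nested limit \<open>t\<close>, then \<open>a\<close>, then \<open>p'\<close> is exactly what the
  stacking of the four sums provides. Counting the positions claimed by smaller indices gives each pair of a
  \<open>\<Pi>\<^sup>0\<^sub>3\<close> index and a colour a position \<open>p\<close> of its own.\<close>

section \<open>Computable functions of finitely many variables\<close>

text \<open>An environment \<open>\<sigma>\<close> supplies the values of all variables. A program for \<open>f\<close> may read any long enough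
  initial segment of it, so that variables can be added and renamed freely.\<close>

definition computable :: "((nat \<Rightarrow> nat) \<Rightarrow> nat) \<Rightarrow> bool" where
  "computable f \<longleftrightarrow> (\<exists>p N. \<forall>\<sigma> n. N \<le> n \<longrightarrow> rec_eval p (map \<sigma> [0..<n]) (f \<sigma>))"

abbreviation decidable :: "((nat \<Rightarrow> nat) \<Rightarrow> bool) \<Rightarrow> bool" where
  "decidable P \<equiv> computable (\<lambda>\<sigma>. of_bool (P \<sigma>))"

lemma computableI:
  "(\<And>\<sigma> n. N \<le> n \<Longrightarrow> rec_eval p (map \<sigma> [0..<n]) (f \<sigma>)) \<Longrightarrow> computable f"
  unfolding computable_def by blast

lemma computableE:
  assumes "computable f"
  obtains p N where "\<And>\<sigma> n. N \<le> n \<Longrightarrow> rec_eval p (map \<sigma> [0..<n]) (f \<sigma>)"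
  using assms unfolding computable_def by blast

lemma computable_var: "computable (\<lambda>\<sigma>. \<sigma> i)"
proof (rule computableI[where N = "Suc i" and p = "Id i"])
  fix \<sigma> :: "nat \<Rightarrow> nat" and n assume "Suc i \<le> n"
  then show "rec_eval (Id i) (map \<sigma> [0..<n]) (\<sigma> i)"
    using rec_eval.rId[of i "map \<sigma> [0..<n]"] by simp
qed

lemma computable_compose:
  assumes "computable f" "\<And>i. computable (g i)"
  shows "computable (\<lambda>\<sigma>. f (\<lambda>i. g i \<sigma>))"
proof -
  obtain p N where p: "\<And>\<sigma> n. N \<le> n \<Longrightarrow> rec_eval p (map \<sigma> [0..<n]) (f \<sigma>)"
    using assms(1) by (rule computableE) blast
  have "\<forall>i. \<exists>q M. \<forall>\<sigma> n. M \<le> n \<longrightarrow> rec_eval q (map \<sigma> [0..<n]) (g i \<sigma>)"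
    using assms(2) unfolding computable_def by blast
  then obtain q M where q: "\<And>i \<sigma> n. M i \<le> n \<Longrightarrow> rec_eval (q i) (map \<sigma> [0..<n]) (g i \<sigma>)"
    by metis
  show ?thesis
  proof (rule computableI[where N = "\<Sum>i<N. M i" and p = "Cn p (map q [0..<N])"])
    fix \<sigma> :: "nat \<Rightarrow> nat" and n assume n: "(\<Sum>i<N. M i) \<le> n"
    have "M i \<le> n" if "i < N" for i
      using member_le_sum[of i "{..<N}" M] that n by simp
    then have "list_all2 (\<lambda>h y. rec_eval h (map \<sigma> [0..<n]) y) (map q [0..<N]) (map (\<lambda>i. g i \<sigma>) [0..<N])"
      using q by (simp add: list_all2_conv_all_nth)
    then show "rec_eval (Cn p (map q [0..<N])) (map \<sigma> [0..<n]) (f (\<lambda>i. g i \<sigma>))"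
      by (rule rec_eval.rCn) (rule p[of N "\<lambda>i. g i \<sigma>", simplified])
  qed
qed

lemma computable_app5:
  assumes "computable (\<lambda>\<sigma>. F (\<sigma> 0) (\<sigma> 1) (\<sigma> 2) (\<sigma> 3) (\<sigma> 4))"
    and "computable a" "computable b" "computable c" "computable d" "computable e"
  shows "computable (\<lambda>\<sigma>. F (a \<sigma>) (b \<sigma>) (c \<sigma>) (d \<sigma>) (e \<sigma>))"
proof -
  let ?args = "\<lambda>i :: nat. if i = 0 then a else if i = 1 then b else if i = 2 then c else if i = 3 then d else e"
  have "computable (?args i)" for i using assms(2-) by simp
  from computable_compose[where g = ?args, OF assms(1) this] show ?thesis by simp
qed

lemma computable_app4:
  assumes "computable (\<lambda>\<sigma>. F (\<sigma> 0) (\<sigma> 1) (\<sigma> 2) (\<sigma> 3))"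
    and "computable a" "computable b" "computable c" "computable d"
  shows "computable (\<lambda>\<sigma>. F (a \<sigma>) (b \<sigma>) (c \<sigma>) (d \<sigma>))"
  using computable_app5[where F = "\<lambda>a b c d _. F a b c d", OF assms assms(5)] .

lemma computable_app3:
  assumes "computable (\<lambda>\<sigma>. F (\<sigma> 0) (\<sigma> 1) (\<sigma> 2))" "computable a" "computable b" "computable c"
  shows "computable (\<lambda>\<sigma>. F (a \<sigma>) (b \<sigma>) (c \<sigma>))"
  using computable_app4[where F = "\<lambda>a b c _. F a b c", OF assms assms(4)] .

lemma computable_app2:
  assumes "computable (\<lambda>\<sigma>. F (\<sigma> 0) (\<sigma> 1))" "computable a" "computable b"
  shows "computable (\<lambda>\<sigma>. F (a \<sigma>) (b \<sigma>))"
  using computable_app3[where F = "\<lambda>a b _. F a b", OF assms assms(3)] .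

lemma computable_app1:
  assumes "computable (\<lambda>\<sigma>. F (\<sigma> 0))" "computable a"
  shows "computable (\<lambda>\<sigma>. F (a \<sigma>))"
  using computable_compose[OF assms(1), of "\<lambda>_. a"] assms(2) by simp

lemma computable_Suc:
  assumes "computable a"
  shows "computable (\<lambda>\<sigma>. Suc (a \<sigma>))"
proof (rule computable_app1[OF _ assms])
  show "computable (\<lambda>\<sigma>. Suc (\<sigma> 0))"
  proof (rule computableI[where N = 1 and p = S])
    fix \<sigma> :: "nat \<Rightarrow> nat" and n :: nat assume "1 \<le> n"
    then show "rec_eval S (map \<sigma> [0..<n]) (Suc (\<sigma> 0))"
      by (simp add: upt_conv_Cons rec_eval.rS)
  qed
qed

lemma computable_const: "computable (\<lambda>\<sigma>. c)"
proof (induction c)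
  case 0
  show ?case by (rule computableI[where N = 0 and p = Z]) (rule rec_eval.rZ)
qed (rule computable_Suc)

subsection \<open>Primitive recursion and bounded quantification\<close>

lemma map_case_nat_upt: "map (case_nat i \<sigma>) [0..<Suc n] = i # map \<sigma> [0..<n]"
  by (simp add: upt_conv_Cons map_Suc_upt[symmetric] comp_def del: map_Suc_upt upt_Suc)

lemma rec_eval_Pr_rec_nat:
  assumes "rec_eval p (map \<sigma> [0..<n]) (g \<sigma>)"
    and step: "\<And>\<tau>. rec_eval q (map \<tau> [0..<Suc (Suc n)]) (h (\<tau> 0) (\<tau> 1) (\<lambda>j. \<tau> (Suc (Suc j))))"
  shows "rec_eval (Pr p q) (i # map \<sigma> [0..<n]) (rec_nat (g \<sigma>) (\<lambda>i acc. h i acc \<sigma>) i)"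
proof (induction i)
  case 0
  show ?case using rec_eval.rPr0[OF assms(1)] by simp
next
  case (Suc i)
  let ?acc = "rec_nat (g \<sigma>) (\<lambda>i acc. h i acc \<sigma>) i"
  have "rec_eval q (i # ?acc # map \<sigma> [0..<n]) (h i ?acc \<sigma>)"
    using step[of "case_nat i (case_nat ?acc \<sigma>)"] unfolding map_case_nat_upt by simp
  then show ?case using rec_eval.rPrS[OF Suc.IH] by simp
qed

lemma computable_rec_nat:
  assumes "computable g" "computable (\<lambda>\<tau>. h (\<tau> 0) (\<tau> 1) (\<lambda>j. \<tau> (Suc (Suc j))))" "computable k"
  shows "computable (\<lambda>\<sigma>. rec_nat (g \<sigma>) (\<lambda>i acc. h i acc \<sigma>) (k \<sigma>))"
proof -
  obtain p N where p: "\<And>\<sigma> n. N \<le> n \<Longrightarrow> rec_eval p (map \<sigma> [0..<n]) (g \<sigma>)"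
    using assms(1) by (rule computableE) blast
  obtain q M where q: "\<And>\<tau> n. M \<le> n \<Longrightarrow>
      rec_eval q (map \<tau> [0..<n]) (h (\<tau> 0) (\<tau> 1) (\<lambda>j. \<tau> (Suc (Suc j))))"
    using assms(2) by (rule computableE) blast
  define K where "K = N + M"
  have rec_eval_Pr: "rec_eval (Pr p q) (i # map \<sigma> [0..<K]) (rec_nat (g \<sigma>) (\<lambda>i acc. h i acc \<sigma>) i)" for i \<sigma>
    by (intro rec_eval_Pr_rec_nat p q) (simp_all add: K_def)
  obtain r L where r: "\<And>\<sigma> n. L \<le> n \<Longrightarrow> rec_eval r (map \<sigma> [0..<n]) (k \<sigma>)"
    using assms(3) by (rule computableE) blast
  show ?thesis
  proof (rule computableI[where N = "L + K" and p = "Cn (Pr p q) (r # map Id [0..<K])"])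
    fix \<sigma> :: "nat \<Rightarrow> nat" and n assume n: "L + K \<le> n"
    have "rec_eval (Id i) (map \<sigma> [0..<n]) (\<sigma> i)" if "i < K" for i
      using rec_eval.rId[of i "map \<sigma> [0..<n]"] that n by simp
    then have "list_all2 (\<lambda>g y. rec_eval g (map \<sigma> [0..<n]) y) (r # map Id [0..<K]) (k \<sigma> # map \<sigma> [0..<K])"
      using r n by (simp add: list_all2_conv_all_nth[of _ "map Id _"])
    then show "rec_eval (Cn (Pr p q) (r # map Id [0..<K])) (map \<sigma> [0..<n])
        (rec_nat (g \<sigma>) (\<lambda>i acc. h i acc \<sigma>) (k \<sigma>))"
      using rec_eval_Pr by (rule rec_eval.rCn)
  qed
qed

lemma computable_add:
  assumes "computable a" "computable b"
  shows "computable (\<lambda>\<sigma>. a \<sigma> + b \<sigma>)"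
proof (rule computable_app2[where F = "(+)", OF _ assms])
  have "rec_nat b (\<lambda>_ acc. Suc acc) a = a + b" for a b :: nat by (induction a) auto
  then show "computable (\<lambda>\<sigma>. \<sigma> 0 + \<sigma> 1)"
    using computable_rec_nat[where g = "\<lambda>\<sigma>. \<sigma> 1" and h = "\<lambda>_ acc _. Suc acc" and k = "\<lambda>\<sigma>. \<sigma> 0"]
    by (simp add: computable_var computable_Suc)
qed

lemma computable_mult:
  assumes "computable a" "computable b"
  shows "computable (\<lambda>\<sigma>. a \<sigma> * b \<sigma>)"
proof (rule computable_app2[where F = "(*)", OF _ assms])
  have "rec_nat 0 (\<lambda>_ acc. acc + b) a = a * b" for a b :: nat by (induction a) auto
  then show "computable (\<lambda>\<sigma>. \<sigma> 0 * \<sigma> 1)"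
    using computable_rec_nat[where g = "\<lambda>\<sigma>. 0" and h = "\<lambda>_ acc \<sigma>. acc + \<sigma> 1" and k = "\<lambda>\<sigma>. \<sigma> 0"]
    by (simp add: computable_var computable_add computable_const)
qed

lemma computable_power:
  assumes "computable a" "computable b"
  shows "computable (\<lambda>\<sigma>. a \<sigma> ^ b \<sigma>)"
proof (rule computable_app2[where F = "(^)", OF _ assms])
  have "rec_nat 1 (\<lambda>_ acc. acc * a) b = a ^ b" for a b :: nat by (induction b) auto
  then show "computable (\<lambda>\<sigma>. \<sigma> 0 ^ \<sigma> 1)"
    using computable_rec_nat[where g = "\<lambda>\<sigma>. 1" and h = "\<lambda>_ acc \<sigma>. acc * \<sigma> 0" and k = "\<lambda>\<sigma>. \<sigma> 1"]
    by (simp add: computable_var computable_mult computable_const)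
qed

lemma computable_pred:
  assumes "computable a"
  shows "computable (\<lambda>\<sigma>. a \<sigma> - 1)"
proof (rule computable_app1[where F = "\<lambda>a. a - 1", OF _ assms])
  have "rec_nat 0 (\<lambda>i _. i) a = a - 1" for a :: nat by (cases a) auto
  then show "computable (\<lambda>\<sigma>. \<sigma> 0 - 1)"
    using computable_rec_nat[where g = "\<lambda>\<sigma>. 0" and h = "\<lambda>i _ _. i" and k = "\<lambda>\<sigma>. \<sigma> 0"]
    by (simp add: computable_var computable_const)
qed

lemma computable_diff:
  assumes "computable a" "computable b"
  shows "computable (\<lambda>\<sigma>. a \<sigma> - b \<sigma>)"
proof (rule computable_app2[where F = "(-)", OF _ assms])
  have "rec_nat a (\<lambda>_ acc. acc - 1) b = a - b" for a b :: nat by (induction b) auto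
  then show "computable (\<lambda>\<sigma>. \<sigma> 0 - \<sigma> 1)"
    using computable_rec_nat[where g = "\<lambda>\<sigma>. \<sigma> 0" and h = "\<lambda>_ acc _. acc - 1" and k = "\<lambda>\<sigma>. \<sigma> 1"]
      computable_pred[of "\<lambda>\<tau>. \<tau> 1"]
    by (simp add: computable_var)
qed

lemma decidable_le:
  assumes "computable a" "computable b"
  shows "decidable (\<lambda>\<sigma>. a \<sigma> \<le> b \<sigma>)"
proof -
  have "(\<lambda>\<sigma>. of_bool (a \<sigma> \<le> b \<sigma>)) = (\<lambda>\<sigma>. 1 - (a \<sigma> - b \<sigma>))" by auto
  then show ?thesis by (simp only: computable_diff computable_const assms)
qed

lemma decidable_not:
  assumes "decidable P"
  shows "decidable (\<lambda>\<sigma>. \<not> P \<sigma>)"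
proof -
  have "(\<lambda>\<sigma>. of_bool (\<not> P \<sigma>)) = (\<lambda>\<sigma>. 1 - (of_bool (P \<sigma>) :: nat))" by auto
  then show ?thesis by (simp only: computable_diff computable_const assms)
qed

lemma decidable_conj:
  assumes "decidable P" "decidable Q"
  shows "decidable (\<lambda>\<sigma>. P \<sigma> \<and> Q \<sigma>)"
  unfolding of_bool_conj by (intro computable_mult assms)

lemma decidable_disj:
  assumes "decidable P" "decidable Q"
  shows "decidable (\<lambda>\<sigma>. P \<sigma> \<or> Q \<sigma>)"
  using decidable_not[OF decidable_conj[OF assms[THEN decidable_not]]] by simp

lemma decidable_imp:
  assumes "decidable P" "decidable Q"
  shows "decidable (\<lambda>\<sigma>. P \<sigma> \<longrightarrow> Q \<sigma>)"
  unfolding imp_conv_disj by (intro decidable_disj decidable_not assms)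

lemma decidable_iff:
  assumes "decidable P" "decidable Q"
  shows "decidable (\<lambda>\<sigma>. P \<sigma> \<longleftrightarrow> Q \<sigma>)"
  unfolding iff_conv_conj_imp by (intro decidable_conj decidable_imp assms)

lemma decidable_less:
  assumes "computable a" "computable b"
  shows "decidable (\<lambda>\<sigma>. a \<sigma> < b \<sigma>)"
  unfolding less_eq_Suc_le by (intro decidable_le computable_Suc assms)

lemma decidable_eq:
  assumes "computable a" "computable b"
  shows "decidable (\<lambda>\<sigma>. a \<sigma> = b \<sigma>)"
  unfolding order_eq_iff by (intro decidable_conj decidable_le assms)

lemma computable_If:
  assumes "decidable P" "computable a" "computable b"
  shows "computable (\<lambda>\<sigma>. if P \<sigma> then a \<sigma> else b \<sigma>)"
proof -
  have "(\<lambda>\<sigma>. if P \<sigma> then a \<sigma> else b \<sigma>) = (\<lambda>\<sigma>. of_bool (P \<sigma>) * a \<sigma> + of_bool (\<not> P \<sigma>) * b \<sigma>)"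
    by auto
  then show ?thesis by (simp only: computable_add computable_mult decidable_not assms)
qed

lemma computable_lift:
  assumes "computable (\<lambda>\<tau>. h (\<tau> 0) (\<lambda>j. \<tau> (Suc j)))"
  shows "computable (\<lambda>\<tau>. h (\<tau> 0) (\<lambda>j. \<tau> (Suc (Suc j))))"
proof -
  let ?args = "case_nat (\<lambda>\<tau>. \<tau> 0) (\<lambda>j \<tau>. \<tau> (Suc (Suc j)))"
  have "computable (?args i)" for i by (cases i) (simp_all add: computable_var)
  from computable_compose[where g = ?args, OF assms this] show ?thesis by simp
qed

lemma computable_sum:
  assumes "computable (\<lambda>\<tau>. h (\<tau> 0) (\<lambda>j. \<tau> (Suc j)))" "computable k"
  shows "computable (\<lambda>\<sigma>. \<Sum>i<k \<sigma>. h i \<sigma>)"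
proof -
  have "computable (\<lambda>\<tau>. \<tau> 1 + h (\<tau> 0) (\<lambda>j. \<tau> (Suc (Suc j))))"
    by (intro computable_add computable_var computable_lift assms)
  moreover have "rec_nat 0 (\<lambda>i acc. acc + h i \<sigma>) n = (\<Sum>i<n. h i \<sigma>)" for n \<sigma>
    by (induction n) auto
  ultimately show ?thesis
    using computable_rec_nat[where g = "\<lambda>_. 0" and h = "\<lambda>i acc \<sigma>. acc + h i \<sigma>" and k = k] assms(2)
    by (simp add: computable_const)
qed

lemma computable_card:
  assumes "decidable (\<lambda>\<tau>. P (\<tau> 0) (\<lambda>j. \<tau> (Suc j)))" "computable k"
  shows "computable (\<lambda>\<sigma>. card {i. i < k \<sigma> \<and> P i \<sigma>})"
proof -
  have "card {i. i < k \<sigma> \<and> P i \<sigma>} = (\<Sum>i<k \<sigma>. of_bool (P i \<sigma>))" for \<sigma>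
    by (simp add: Int_def)
  then show ?thesis by (simp only:) (intro computable_sum assms)
qed

lemma decidable_ex_less:
  assumes "decidable (\<lambda>\<tau>. P (\<tau> 0) (\<lambda>j. \<tau> (Suc j)))" "computable k"
  shows "decidable (\<lambda>\<sigma>. \<exists>i<k \<sigma>. P i \<sigma>)"
proof -
  have "(\<exists>i<k \<sigma>. P i \<sigma>) \<longleftrightarrow> 0 < card {i. i < k \<sigma> \<and> P i \<sigma>}" for \<sigma>
    by (auto simp: card_gt_0_iff)
  then show ?thesis by (simp only:) (intro decidable_less computable_card computable_const assms)
qed

lemma decidable_all_less:
  assumes "decidable (\<lambda>\<tau>. P (\<tau> 0) (\<lambda>j. \<tau> (Suc j)))" "computable k"
  shows "decidable (\<lambda>\<sigma>. \<forall>i<k \<sigma>. P i \<sigma>)"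
  using decidable_not[OF decidable_ex_less[OF decidable_not[OF assms(1)] assms(2)]] by simp

lemma decidable_ex_le:
  assumes "decidable (\<lambda>\<tau>. P (\<tau> 0) (\<lambda>j. \<tau> (Suc j)))" "computable k"
  shows "decidable (\<lambda>\<sigma>. \<exists>i\<le>k \<sigma>. P i \<sigma>)"
  unfolding less_Suc_eq_le[symmetric] by (intro decidable_ex_less computable_Suc assms)

lemma decidable_all_le:
  assumes "decidable (\<lambda>\<tau>. P (\<tau> 0) (\<lambda>j. \<tau> (Suc j)))" "computable k"
  shows "decidable (\<lambda>\<sigma>. \<forall>i\<le>k \<sigma>. P i \<sigma>)"
  unfolding less_Suc_eq_le[symmetric] by (intro decidable_all_less computable_Suc assms)

definition bounded_Least :: "nat \<Rightarrow> (nat \<Rightarrow> bool) \<Rightarrow> nat" where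
  "bounded_Least k P = (LEAST i. k \<le> i \<or> P i)"

lemma bounded_Least_eqI:
  assumes "P i" "i \<le> k" "\<And>j. j < i \<Longrightarrow> \<not> P j"
  shows "bounded_Least k P = i"
  unfolding bounded_Least_def using assms by (intro Least_equality) (auto intro: leI)

lemma bounded_Least_le: "P i \<Longrightarrow> bounded_Least k P \<le> i"
  unfolding bounded_Least_def by (rule Least_le) simp

lemma bounded_LeastI:
  assumes "P i" "i < k"
  shows "P (bounded_Least k P)"
proof -
  have "k \<le> bounded_Least k P \<or> P (bounded_Least k P)"
    unfolding bounded_Least_def using LeastI[of "\<lambda>i. k \<le> i \<or> P i" i] assms(1) by blast
  with bounded_Least_le[of P i k] assms show ?thesis by auto
qed

lemma less_bounded_Least_iff: "i < bounded_Least k P \<longleftrightarrow> i < k \<and> (\<forall>j\<le>i. \<not> P j)"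
proof
  assume "i < bounded_Least k P"
  then have "\<not> (k \<le> j \<or> P j)" if "j \<le> i" for j
    unfolding bounded_Least_def using that by (intro not_less_Least) simp
  then show "i < k \<and> (\<forall>j\<le>i. \<not> P j)" by (auto simp: not_le)
next
  assume "i < k \<and> (\<forall>j\<le>i. \<not> P j)"
  moreover have "k \<le> bounded_Least k P \<or> P (bounded_Least k P)"
    unfolding bounded_Least_def by (rule LeastI[of _ k]) simp
  ultimately show "i < bounded_Least k P" by (meson leI less_le_trans)
qed

lemma bounded_Least_eq_card: "bounded_Least k P = card {i. i < k \<and> (\<forall>j\<le>i. \<not> P j)}"
  by (simp flip: less_bounded_Least_iff)

lemma computable_bounded_Least:
  assumes "decidable (\<lambda>\<tau>. P (\<tau> 0) (\<lambda>j. \<tau> (Suc j)))" "computable k"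
  shows "computable (\<lambda>\<sigma>. bounded_Least (k \<sigma>) (\<lambda>i. P i \<sigma>))"
proof -
  have "decidable (\<lambda>\<tau>. \<forall>j\<le>\<tau> 0. \<not> P j (\<lambda>j. \<tau> (Suc j)))"
    using computable_lift[OF assms(1)] by (intro decidable_all_le decidable_not computable_var) simp
  then show ?thesis unfolding bounded_Least_eq_card by (intro computable_card assms)
qed

subsection \<open>Arithmetic and coding functions\<close>

lemma computable_div:
  assumes "computable a" "computable b"
  shows "computable (\<lambda>\<sigma>. a \<sigma> div b \<sigma>)"
proof (rule computable_app2[where F = "(div)", OF _ assms])
  have "a div b = card {q. q < a \<and> 0 < b \<and> Suc q * b \<le> a}" for a b :: nat
  proof (cases "b = 0")
    case False
    then have "{q. Suc q * b \<le> a} = {..<a div b}"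
      by (simp add: less_eq_div_iff_mult_less_eq less_eq_Suc_le set_eq_iff del: mult_Suc)
    moreover from this have "{q. Suc q * b \<le> a} \<subseteq> {..<a}" by (simp del: mult_Suc)
    then have "{q. q < a \<and> 0 < b \<and> Suc q * b \<le> a} = {q. Suc q * b \<le> a}" using False by auto
    ultimately show ?thesis by simp
  qed simp
  then show "computable (\<lambda>\<sigma>. \<sigma> 0 div \<sigma> 1)"
    by (simp only:) (intro computable_card decidable_conj decidable_less decidable_le computable_mult
        computable_Suc computable_const computable_var)
qed

lemma computable_mod:
  assumes "computable a" "computable b"
  shows "computable (\<lambda>\<sigma>. a \<sigma> mod b \<sigma>)"
  unfolding modulo_nat_def by (intro computable_diff computable_mult computable_div assms)

lemma decidable_dvd:
  assumes "computable a" "computable b"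
  shows "decidable (\<lambda>\<sigma>. a \<sigma> dvd b \<sigma>)"
  unfolding dvd_eq_mod_eq_0 by (intro decidable_eq computable_mod computable_const assms)

lemmas computable_basic_intros = computable_var computable_const computable_Suc computable_add
  computable_mult computable_diff computable_power computable_div computable_mod computable_If
  computable_sum computable_card computable_bounded_Least decidable_le decidable_less decidable_eq decidable_not
  decidable_conj decidable_disj decidable_imp decidable_iff decidable_ex_less decidable_all_less
  decidable_ex_le decidable_all_le decidable_dvd

lemma bit_iff_set_decode: "bit x j \<longleftrightarrow> j \<in> set_decode x"
  by (simp add: set_decode_def bit_iff_odd)

lemma decidable_set_decode:
  assumes "computable a" "computable b"
  shows "decidable (\<lambda>\<sigma>. a \<sigma> \<in> set_decode (b \<sigma>))"
  unfolding set_decode_def mem_Collect_eq by (intro computable_basic_intros assms)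

lemma set_decode_less: "j \<in> set_decode x \<Longrightarrow> x < 2 ^ s \<Longrightarrow> j < s"
  by (metis bit_iff_set_decode bit_take_bit_iff take_bit_nat_eq_self)

lemma mem_set_decode_less: "j \<in> set_decode x \<Longrightarrow> j < x"
  using set_decode_less[of j x x] less_exp[of x] by blast

lemma set_decode_eq_Int_lessThan: "set_decode x = {..<x} \<inter> {j. j \<in> set_decode x}"
  by (auto intro: mem_set_decode_less)

lemma computable_sum_set_decode:
  assumes "computable (\<lambda>\<tau>. h (\<tau> 0) (\<lambda>j. \<tau> (Suc j)))" "computable a" "computable (\<lambda>\<tau>. a (\<lambda>j. \<tau> (Suc j)))"
  shows "computable (\<lambda>\<sigma>. \<Sum>j\<in>set_decode (a \<sigma>). h j \<sigma>)"
proof -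
  have "(\<Sum>j\<in>set_decode (a \<sigma>). h j \<sigma>) = (\<Sum>j<a \<sigma>. if j \<in> set_decode (a \<sigma>) then h j \<sigma> else 0)" for \<sigma>
    by (subst set_decode_eq_Int_lessThan) (simp add: sum.If_cases)
  then show ?thesis
    by (simp only:) (intro computable_basic_intros decidable_set_decode assms)
qed

lemma decidable_ball_set_decode:
  assumes "decidable (\<lambda>\<tau>. P (\<tau> 0) (\<lambda>j. \<tau> (Suc j)))" "computable a" "computable (\<lambda>\<tau>. a (\<lambda>j. \<tau> (Suc j)))"
  shows "decidable (\<lambda>\<sigma>. \<forall>j\<in>set_decode (a \<sigma>). P j \<sigma>)"
proof -
  have "(\<forall>j\<in>set_decode (a \<sigma>). P j \<sigma>) \<longleftrightarrow> (\<forall>j<a \<sigma>. j \<in> set_decode (a \<sigma>) \<longrightarrow> P j \<sigma>)" for \<sigma>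
    using mem_set_decode_less by blast
  then show ?thesis
    by (simp only:) (intro computable_basic_intros decidable_set_decode assms)
qed

lemma computable_take_bit:
  assumes "computable a" "computable b"
  shows "computable (\<lambda>\<sigma>. take_bit (a \<sigma>) (b \<sigma>))"
  unfolding take_bit_eq_mod by (intro computable_basic_intros assms)

lemma computable_floor_log:
  assumes "computable a"
  shows "computable (\<lambda>\<sigma>. floor_log (a \<sigma>))"
proof -
  have "floor_log x = bounded_Least x (\<lambda>k. x < 2 * 2 ^ k)" for x
  proof (rule bounded_Least_eqI[symmetric])
    show "x < 2 * 2 ^ floor_log x" by (rule floor_log_exp2_gt)
    show "floor_log x \<le> x" using floor_log_mono[THEN monoD, of x "2 ^ x"] by simp
    show "\<not> x < 2 * 2 ^ k" if "k < floor_log x" for k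
    proof -
      have "2 * 2 ^ k \<le> (2::nat) ^ floor_log x"
        using that power_increasing[of "Suc k" "floor_log x" "2::nat"] by simp
      also have "\<dots> \<le> x" using that by (intro floor_log_exp2_le) (cases x; simp)
      finally show ?thesis by simp
    qed
  qed
  then have "computable (\<lambda>\<sigma>. floor_log (\<sigma> 0))"
    by (simp only:) (intro computable_basic_intros)
  then show ?thesis using assms by (rule computable_app1)
qed

lemma computable_prod_encode:
  assumes "computable a" "computable b"
  shows "computable (\<lambda>\<sigma>. prod_encode (a \<sigma>, b \<sigma>))"
  unfolding prod_encode_def triangle_def prod.case by (intro computable_basic_intros assms)

lemma computable_prod_decode:
  assumes "computable a"
  shows "computable (\<lambda>\<sigma>. fst (prod_decode (a \<sigma>)))" "computable (\<lambda>\<sigma>. snd (prod_decode (a \<sigma>)))"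
proof -
  have eq: "fst (prod_decode n) = bounded_Least n (\<lambda>i. \<exists>j\<le>n. prod_encode (i, j) = n)"
    "snd (prod_decode n) = bounded_Least n (\<lambda>j. \<exists>i\<le>n. prod_encode (i, j) = n)" for n
  proof -
    obtain i j where "n = prod_encode (i, j)" by (metis prod_decode_inverse surj_pair)
    then show "fst (prod_decode n) = bounded_Least n (\<lambda>i. \<exists>j\<le>n. prod_encode (i, j) = n)"
      "snd (prod_decode n) = bounded_Least n (\<lambda>j. \<exists>i\<le>n. prod_encode (i, j) = n)"
      by (auto intro!: bounded_Least_eqI[symmetric] le_prod_encode_1 le_prod_encode_2)
  qed
  have "computable (\<lambda>\<sigma>. fst (prod_decode (\<sigma> 0)))" "computable (\<lambda>\<sigma>. snd (prod_decode (\<sigma> 0)))"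
    unfolding eq by (intro computable_basic_intros computable_prod_encode)+
  from this[THEN computable_app1, OF assms]
  show "computable (\<lambda>\<sigma>. fst (prod_decode (a \<sigma>)))" "computable (\<lambda>\<sigma>. snd (prod_decode (a \<sigma>)))" .
qed

lemma recursive1I:
  assumes "computable (\<lambda>\<sigma>. f (\<sigma> 0))"
  shows "recursive1 f"
proof -
  obtain p N where p: "\<And>\<sigma> n. N \<le> n \<Longrightarrow> rec_eval p (map \<sigma> [0..<n]) (f (\<sigma> 0))"
    using assms by (rule computableE) blast
  have "rec_eval (Cn p (replicate (Suc N) (Id 0))) [x] (f x)" for x
  proof (rule rec_eval.rCn)
    show "list_all2 (\<lambda>g y. rec_eval g [x] y) (replicate (Suc N) (Id 0)) (map (\<lambda>_. x) [0..<Suc N])"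
      using rec_eval.rId[of 0 "[x]"] by (simp add: list_all2_conv_all_nth del: upt_Suc replicate_Suc)
    show "rec_eval p (map (\<lambda>_. x) [0..<Suc N]) (f x)"
      using p[of "Suc N" "\<lambda>_. x"] by simp
  qed
  then show ?thesis unfolding recursive1_def by blast
qed

section \<open>Finite derivations of evaluation judgements\<close>

definition code_Cons :: "nat \<Rightarrow> nat \<Rightarrow> nat" where
  "code_Cons x l = Suc (prod_encode (x, l))"

definition code_tl :: "nat \<Rightarrow> nat" where
  "code_tl l = snd (prod_decode (l - 1))"

definition code_nth :: "nat \<Rightarrow> nat \<Rightarrow> nat" where
  "code_nth l i = fst (prod_decode ((code_tl ^^ i) l - 1))"

definition code_length :: "nat \<Rightarrow> nat" where
  "code_length l = length (list_decode l)"

lemma code_Cons_list_encode [simp]: "code_Cons x (list_encode xs) = list_encode (x # xs)"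
  by (simp add: code_Cons_def)

lemma code_length_list_encode [simp]: "code_length (list_encode xs) = length xs"
  by (simp add: code_length_def)

lemma list_encode_eq_0_iff [simp]: "list_encode xs = 0 \<longleftrightarrow> xs = []"
  by (cases xs) auto

lemma code_tl_list_encode [simp]: "code_tl (list_encode xs) = list_encode (tl xs)"
proof (cases xs)
  case Nil
  have "prod_decode 0 = (0, 0)" using prod_encode_inverse[of "(0, 0)"] by (simp add: prod_encode_def)
  then show ?thesis using Nil by (simp add: code_tl_def)
qed (simp add: code_tl_def)

lemma funpow_code_tl_list_encode: "(code_tl ^^ i) (list_encode xs) = list_encode (drop i xs)"
  by (induction i) (simp_all add: drop_Suc tl_drop)

lemma code_nth_list_encode [simp]:
  assumes "i < length xs"
  shows "code_nth (list_encode xs) i = xs ! i"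
  using Cons_nth_drop_Suc[OF assms, symmetric] by (simp add: code_nth_def funpow_code_tl_list_encode)

lemma length_le_list_encode: "length xs \<le> list_encode xs"
  by (induction xs) (auto intro: order_trans[OF _ le_prod_encode_2])

lemma code_length_eq_card: "code_length l = card {i. i < l \<and> (code_tl ^^ i) l \<noteq> 0}"
proof -
  obtain xs where l: "l = list_encode xs" by (metis list_decode_inverse)
  have "{i. i < l \<and> i < length xs} = {..<length xs}"
    using length_le_list_encode[of xs] by (auto simp: l)
  then show ?thesis by (simp add: l funpow_code_tl_list_encode not_le)
qed

declare list_encode.simps(2) [simp del]

lemma computable_code_Cons:
  assumes "computable a" "computable b"
  shows "computable (\<lambda>\<sigma>. code_Cons (a \<sigma>) (b \<sigma>))"
  unfolding code_Cons_def by (intro computable_Suc computable_prod_encode assms)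

lemma computable_code_tl:
  assumes "computable a"
  shows "computable (\<lambda>\<sigma>. code_tl (a \<sigma>))"
  unfolding code_tl_def by (intro computable_prod_decode computable_diff computable_const assms)

lemma computable_funpow_code_tl:
  assumes "computable a" "computable b"
  shows "computable (\<lambda>\<sigma>. (code_tl ^^ a \<sigma>) (b \<sigma>))"
proof -
  have "(code_tl ^^ i) l = rec_nat l (\<lambda>_. code_tl) i" for i l
    by (induction i) simp_all
  then show ?thesis
    using computable_rec_nat[where h = "\<lambda>_ acc _. code_tl acc", OF assms(2) _ assms(1)]
    by (simp add: computable_code_tl computable_var)
qed

lemma computable_code_nth:
  assumes "computable a" "computable b"
  shows "computable (\<lambda>\<sigma>. code_nth (a \<sigma>) (b \<sigma>))"
  unfolding code_nth_def
  by (intro computable_prod_decode computable_diff computable_funpow_code_tl computable_const assms)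

lemma computable_code_length:
  assumes "computable a"
  shows "computable (\<lambda>\<sigma>. code_length (a \<sigma>))"
proof (rule computable_app1[OF _ assms])
  show "computable (\<lambda>\<sigma>. code_length (\<sigma> 0))"
    unfolding code_length_eq_card by (intro computable_basic_intros computable_funpow_code_tl)
qed

fun recf_encode :: "recf \<Rightarrow> nat" where
  "recf_encode Z = prod_encode (0, 0)"
| "recf_encode S = prod_encode (1, 0)"
| "recf_encode (Id i) = prod_encode (2, i)"
| "recf_encode (Cn f gs) = prod_encode (3, prod_encode (recf_encode f, list_encode (map recf_encode gs)))"
| "recf_encode (Pr f g) = prod_encode (4, prod_encode (recf_encode f, recf_encode g))"
| "recf_encode (Mn f) = prod_encode (5, recf_encode f)"

abbreviation tag :: "nat \<Rightarrow> nat" where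
  "tag f \<equiv> fst (prod_decode f)"

abbreviation arg :: "nat \<Rightarrow> nat" where
  "arg f \<equiv> snd (prod_decode f)"

abbreviation arg1 :: "nat \<Rightarrow> nat" where
  "arg1 f \<equiv> fst (prod_decode (arg f))"

abbreviation arg2 :: "nat \<Rightarrow> nat" where
  "arg2 f \<equiv> snd (prod_decode (arg f))"

text \<open>The judgement that the program coded by \<open>f\<close> maps the list coded by \<open>xs\<close> to \<open>y\<close>.\<close>

definition judgement :: "nat \<Rightarrow> nat \<Rightarrow> nat \<Rightarrow> nat" where
  "judgement f xs y = prod_encode (f, prod_encode (xs, y))"

text \<open>The set coded by \<open>W\<close> supplies the premises of one evaluation rule. Every component of a judgement in
  this set is below \<open>W\<close>, so the bounds do not exclude any premise.\<close>

definition inferable :: "nat \<Rightarrow> nat \<Rightarrow> nat \<Rightarrow> nat \<Rightarrow> bool" where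
  "inferable W f xs y \<longleftrightarrow>
     tag f = 0 \<and> y = 0
   \<or> tag f = 1 \<and> xs \<noteq> 0 \<and> y = Suc (code_nth xs 0)
   \<or> tag f = 2 \<and> arg f < code_length xs \<and> y = code_nth xs (arg f)
   \<or> tag f = 3 \<and> (\<exists>ys\<le>W. judgement (arg1 f) ys y \<in> set_decode W \<and>
        code_length ys = code_length (arg2 f) \<and>
        (\<forall>i<code_length ys. judgement (code_nth (arg2 f) i) xs (code_nth ys i) \<in> set_decode W))
   \<or> tag f = 4 \<and> xs \<noteq> 0 \<and> code_nth xs 0 = 0 \<and> judgement (arg1 f) (code_tl xs) y \<in> set_decode W
   \<or> tag f = 4 \<and> xs \<noteq> 0 \<and> (\<exists>n<code_nth xs 0. code_nth xs 0 = Suc n \<and>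
        (\<exists>v\<le>W. judgement f (code_Cons n (code_tl xs)) v \<in> set_decode W \<and>
          judgement (arg2 f) (code_Cons n (code_Cons v (code_tl xs))) y \<in> set_decode W))
   \<or> tag f = 5 \<and> judgement (arg f) (code_Cons y xs) 0 \<in> set_decode W \<and>
        (\<forall>m<y. \<exists>v\<le>W. 0 < v \<and> judgement (arg f) (code_Cons m xs) v \<in> set_decode W)"

definition derivation :: "nat \<Rightarrow> bool" where
  "derivation W \<longleftrightarrow>
     (\<forall>f\<le>W. \<forall>xs\<le>W. \<forall>y\<le>W. judgement f xs y \<in> set_decode W \<longrightarrow> inferable W f xs y)"

definition asserts :: "nat \<Rightarrow> recf \<Rightarrow> nat list \<Rightarrow> nat \<Rightarrow> bool" where
  "asserts W p xs y \<longleftrightarrow> judgement (recf_encode p) (list_encode xs) y \<in> set_decode W"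

lemma computable_judgement:
  assumes "computable a" "computable b" "computable c"
  shows "computable (\<lambda>\<sigma>. judgement (a \<sigma>) (b \<sigma>) (c \<sigma>))"
  unfolding judgement_def by (intro computable_prod_encode assms)

lemma decidable_derivation:
  assumes "computable a"
  shows "decidable (\<lambda>\<sigma>. derivation (a \<sigma>))"
proof -
  have "decidable (\<lambda>\<sigma>. inferable (\<sigma> 0) (\<sigma> 1) (\<sigma> 2) (\<sigma> 3))"
    unfolding inferable_def
    by (intro computable_basic_intros decidable_set_decode computable_prod_decode computable_judgement
        computable_code_Cons computable_code_tl computable_code_nth computable_code_length)
  note decidable_inferable = computable_app4[where F = "\<lambda>W f xs y. of_bool (inferable W f xs y)", OF this]
  have "decidable (\<lambda>\<sigma>. derivation (\<sigma> 0))"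
    unfolding derivation_def
    by (intro computable_basic_intros decidable_set_decode computable_judgement decidable_inferable)
  then show ?thesis using assms by (rule computable_app1)
qed

lemma judgement_le:
  assumes "judgement f xs y \<in> set_decode W"
  shows "f \<le> W" "xs \<le> W" "y \<le> W"
  using mem_set_decode_less[OF assms] le_prod_encode_1 le_prod_encode_2
  unfolding judgement_def by (meson less_imp_le order_trans)+

lemma derivationD: "derivation W \<Longrightarrow> judgement f xs y \<in> set_decode W \<Longrightarrow> inferable W f xs y"
  unfolding derivation_def using judgement_le by blast

lemma asserts_le:
  assumes "asserts W p xs y"
  shows "list_encode xs \<le> W" "y \<le> W"
  using assms judgement_le unfolding asserts_def by blast+

lemma inferable_Z: "inferable W (recf_encode Z) (list_encode xs) y \<longleftrightarrow> y = 0"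
  by (simp add: inferable_def)

lemma inferable_S: "inferable W (recf_encode S) (list_encode xs) y \<longleftrightarrow> (\<exists>x xs'. xs = x # xs' \<and> y = Suc x)"
  by (cases xs) (simp_all add: inferable_def)

lemma inferable_Id: "inferable W (recf_encode (Id i)) (list_encode xs) y \<longleftrightarrow> i < length xs \<and> y = xs ! i"
  by (auto simp: inferable_def)

lemma inferable_Cn:
  "inferable W (recf_encode (Cn f gs)) (list_encode xs) y \<longleftrightarrow>
     (\<exists>ys. asserts W f ys y \<and> list_all2 (\<lambda>g z. asserts W g xs z) gs ys)"
proof -
  define supported where "supported l \<longleftrightarrow> judgement (recf_encode f) l y \<in> set_decode W \<and>
    code_length l = length gs \<and> (\<forall>i<code_length l. judgement (code_nth (list_encode (map recf_encode gs)) i)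
      (list_encode xs) (code_nth l i) \<in> set_decode W)" for l
  have "supported (list_encode ys) \<longleftrightarrow> asserts W f ys y \<and> list_all2 (\<lambda>g z. asserts W g xs z) gs ys" for ys
    by (auto simp: supported_def asserts_def list_all2_conv_all_nth)
  moreover have "inferable W (recf_encode (Cn f gs)) (list_encode xs) y \<longleftrightarrow> (\<exists>l\<le>W. supported l)"
    by (simp add: inferable_def supported_def)
  ultimately show ?thesis by (metis asserts_le(1) list_decode_inverse)
qed

lemma inferable_Pr:
  "inferable W (recf_encode (Pr f g)) (list_encode xs) y \<longleftrightarrow>
     (\<exists>xs'. xs = 0 # xs' \<and> asserts W f xs' y) \<or>
     (\<exists>n xs' v. xs = Suc n # xs' \<and> asserts W (Pr f g) (n # xs') v \<and> asserts W g (n # v # xs') y)"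
proof (cases xs)
  case (Cons x xs')
  have "(\<exists>v\<le>W. asserts W (Pr f g) (n # xs') v \<and> asserts W g (n # v # xs') y) \<longleftrightarrow>
    (\<exists>v. asserts W (Pr f g) (n # xs') v \<and> asserts W g (n # v # xs') y)" for n
    using asserts_le(2) by blast
  then show ?thesis
    by (cases x) (simp_all add: Cons inferable_def asserts_def)
qed (simp add: inferable_def)

lemma inferable_Mn:
  "inferable W (recf_encode (Mn f)) (list_encode xs) y \<longleftrightarrow>
     asserts W f (y # xs) 0 \<and> (\<forall>m<y. \<exists>v. 0 < v \<and> asserts W f (m # xs) v)"
proof -
  have "(\<exists>v\<le>W. 0 < v \<and> asserts W f (m # xs) v) \<longleftrightarrow> (\<exists>v. 0 < v \<and> asserts W f (m # xs) v)" for m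
    using asserts_le(2) by blast
  then show ?thesis by (simp add: inferable_def asserts_def)
qed

declare recf_encode.simps [simp del]

lemma inferable_if_asserts:
  "derivation W \<Longrightarrow> asserts W p xs y \<Longrightarrow> inferable W (recf_encode p) (list_encode xs) y"
  unfolding asserts_def by (rule derivationD)

lemma rec_eval_Pr_if_asserts:
  assumes "derivation W"
    and base: "\<And>xs y. asserts W f xs y \<Longrightarrow> rec_eval f xs y"
    and step: "\<And>xs y. asserts W g xs y \<Longrightarrow> rec_eval g xs y"
  shows "asserts W (Pr f g) (n # xs) y \<Longrightarrow> rec_eval (Pr f g) (n # xs) y"
proof (induction n arbitrary: y)
  case 0
  from inferable_if_asserts[OF assms(1) this] show ?case
    using base by (auto simp: inferable_Pr intro: rec_eval.rPr0)
next
  case (Suc n)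
  from inferable_if_asserts[OF assms(1) Suc.prems] obtain v
    where "asserts W (Pr f g) (n # xs) v" "asserts W g (n # v # xs) y"
    unfolding inferable_Pr by blast
  then show ?case using Suc.IH step by (intro rec_eval.rPrS)
qed

lemma rec_eval_if_asserts:
  assumes "derivation W"
  shows "asserts W p xs y \<Longrightarrow> rec_eval p xs y"
proof (induction p arbitrary: xs y)
  case Z
  from inferable_if_asserts[OF assms this] show ?case by (simp add: inferable_Z rec_eval.rZ)
next
  case S
  from inferable_if_asserts[OF assms this] show ?case by (auto simp: inferable_S intro: rec_eval.rS)
next
  case (Id i)
  from inferable_if_asserts[OF assms this] show ?case by (auto simp: inferable_Id intro: rec_eval.rId)
next
  case (Cn f gs)
  from inferable_if_asserts[OF assms Cn.prems] obtain ys
    where ys: "asserts W f ys y" "list_all2 (\<lambda>g z. asserts W g xs z) gs ys"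
    unfolding inferable_Cn by blast
  from ys(2) have "list_all2 (\<lambda>g z. rec_eval g xs z) gs ys"
    by (rule list.rel_mono_strong) (rule Cn.IH(2))
  then show ?case using Cn.IH(1)[OF ys(1)] by (rule rec_eval.rCn)
next
  case (Pr f g)
  from inferable_if_asserts[OF assms Pr.prems] obtain n zs where "xs = n # zs"
    unfolding inferable_Pr by blast
  then show ?case using rec_eval_Pr_if_asserts[OF assms Pr.IH] Pr.prems by simp
next
  case (Mn f)
  from inferable_if_asserts[OF assms Mn.prems] show ?case
    using Mn.IH unfolding inferable_Mn by (blast intro: rec_eval.rMn)
qed

lemma inferable_mono:
  assumes "set_decode W \<subseteq> set_decode W'" "inferable W f xs y"
  shows "inferable W' f xs y"
proof -
  have mem_imp: "j \<in> set_decode W \<longrightarrow> j \<in> set_decode W'" and le_imp: "v \<le> W \<longrightarrow> v \<le> W'" for j v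
    using assms(1) subset_decode_imp_le[OF assms(1)] by auto
  have "inferable W f xs y \<longrightarrow> inferable W' f xs y"
    unfolding inferable_def
    by (intro imp_refl disj_mono conj_mono ex_mono all_mono imp_mono mem_imp le_imp)
  with assms(2) show ?thesis by blast
qed

definition derivable :: "nat \<Rightarrow> bool" where
  "derivable j \<longleftrightarrow> (\<exists>W. derivation W \<and> j \<in> set_decode W)"

lemma derivationI:
  assumes "\<And>f xs y. judgement f xs y \<in> set_decode W \<Longrightarrow>
    \<exists>V. set_decode V \<subseteq> set_decode W \<and> inferable V f xs y"
  shows "derivation W"
  unfolding derivation_def using assms inferable_mono by blast

lemma derivation_UN:
  assumes "finite J" "\<And>j. j \<in> J \<Longrightarrow> derivation (V j)"
  shows "derivation (set_encode (\<Union>j\<in>J. set_decode (V j)))" (is "derivation ?W")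
proof (rule derivationI)
  fix f xs y assume "judgement f xs y \<in> set_decode ?W"
  then obtain j where "j \<in> J" "judgement f xs y \<in> set_decode (V j)" using assms(1) by auto
  then show "\<exists>V. set_decode V \<subseteq> set_decode ?W \<and> inferable V f xs y"
    using assms by (intro exI[of _ "V j"]) (auto intro: derivationD)
qed

lemma derivation_insert:
  assumes "derivation W" "inferable W f xs y"
  shows "derivation (set_encode (insert (judgement f xs y) (set_decode W)))" (is "derivation ?W'")
proof (rule derivationI)
  fix f' xs' y' assume "judgement f' xs' y' \<in> set_decode ?W'"
  then have "inferable W f' xs' y'" using assms derivationD by (auto simp: judgement_def)
  then show "\<exists>V. set_decode V \<subseteq> set_decode ?W' \<and> inferable V f' xs' y'"
    by (intro exI[of _ W]) auto
qed

lemma derivableI: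
  assumes "finite J" "\<And>j. j \<in> J \<Longrightarrow> derivable j" "\<And>W. J \<subseteq> set_decode W \<Longrightarrow> inferable W f xs y"
  shows "derivable (judgement f xs y)"
proof -
  obtain V where V: "\<And>j. j \<in> J \<Longrightarrow> derivation (V j) \<and> j \<in> set_decode (V j)"
    using assms(2) unfolding derivable_def by metis
  define W where "W = set_encode (\<Union>j\<in>J. set_decode (V j))"
  have "derivation W" unfolding W_def using assms(1) V by (intro derivation_UN) auto
  moreover have "J \<subseteq> set_decode W" unfolding W_def using assms(1) V by auto
  ultimately have "derivation (set_encode (insert (judgement f xs y) (set_decode W)))"
    by (intro derivation_insert assms(3))
  moreover have "judgement f xs y \<in> set_decode (set_encode (insert (judgement f xs y) (set_decode W)))"
    by simp
  ultimately show ?thesis unfolding derivable_def by blast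
qed

lemma derivable_Cn:
  assumes "derivable (judgement (recf_encode f) (list_encode ys) y)"
    and "list_all2 (\<lambda>g z. derivable (judgement (recf_encode g) (list_encode xs) z)) gs ys"
  shows "derivable (judgement (recf_encode (Cn f gs)) (list_encode xs) y)"
proof (rule derivableI)
  let ?J = "insert (judgement (recf_encode f) (list_encode ys) y)
    ((\<lambda>i. judgement (recf_encode (gs ! i)) (list_encode xs) (ys ! i)) ` {..<length gs})"
  show "finite ?J" by simp
  show "derivable j" if "j \<in> ?J" for j
    using that assms by (auto simp: list_all2_conv_all_nth)
  show "inferable W (recf_encode (Cn f gs)) (list_encode xs) y" if "?J \<subseteq> set_decode W" for W
    unfolding inferable_Cn asserts_def
    using that assms(2) by (intro exI[of _ ys]) (auto simp: list_all2_conv_all_nth)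
qed

lemma derivable_if_rec_eval: "rec_eval p xs y \<Longrightarrow> derivable (judgement (recf_encode p) (list_encode xs) y)"
proof (induction rule: rec_eval.induct)
  case (rZ xs)
  show ?case by (rule derivableI[of "{}"]) (simp_all only: inferable_Z finite.emptyI empty_iff)
next
  case (rS x xs)
  show ?case by (rule derivableI[of "{}"]) (auto simp only: inferable_S)
next
  case (rId i xs)
  then show ?case by (intro derivableI[of "{}"]) (auto simp only: inferable_Id)
next
  case (rCn xs gs ys f y)
  then show ?case by (intro derivable_Cn) (auto elim: list.rel_mono_strong)
next
  case (rPr0 f xs y g)
  then show ?case
    by (intro derivableI[of "{judgement (recf_encode f) (list_encode xs) y}"])
      (auto simp: inferable_Pr asserts_def)
next
  case (rPrS f g n xs y z)
  then show ?case
    by (intro derivableI[of "{judgement (recf_encode (Pr f g)) (list_encode (n # xs)) y,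
        judgement (recf_encode g) (list_encode (n # y # xs)) z}"]) (auto simp: inferable_Pr asserts_def)
next
  case (rMn f n xs)
  from rMn.IH(2) obtain v where
    "\<And>m. m < n \<Longrightarrow> derivable (judgement (recf_encode f) (list_encode (m # xs)) (v m)) \<and> 0 < v m"
    by metis
  with rMn.IH(1) show ?case
    by (intro derivableI[of "insert (judgement (recf_encode f) (list_encode (n # xs)) 0)
        ((\<lambda>m. judgement (recf_encode f) (list_encode (m # xs)) (v m)) ` {..<n})"])
      (auto simp: inferable_Mn asserts_def)
qed

lemma rec_eval_iff_derivation: "rec_eval p xs y \<longleftrightarrow> (\<exists>W. derivation W \<and> asserts W p xs y)"
  using derivable_if_rec_eval rec_eval_if_asserts unfolding derivable_def asserts_def by blast

lemma rec_eval_deterministic: "rec_eval p xs y \<Longrightarrow> rec_eval p xs y' \<Longrightarrow> y' = y"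
proof (induction arbitrary: y' rule: rec_eval.induct)
  case (rZ xs)
  then show ?case by (auto elim: rec_eval.cases)
next
  case (rS x xs)
  then show ?case by (auto elim: rec_eval.cases)
next
  case (rId i xs)
  from rId(2) show ?case by (auto elim: rec_eval.cases)
next
  case (rCn xs gs ys f y)
  from rCn.prems obtain zs where zs: "list_all2 (\<lambda>g y. rec_eval g xs y) gs zs" "rec_eval f zs y'"
    by (auto elim: rec_eval.cases)
  have "zs = ys"
    using rCn.IH(1) zs(1) by (auto simp: list_all2_conv_all_nth intro!: nth_equalityI)
  with rCn.IH(2) zs(2) show ?case by simp
next
  case (rPr0 f xs y g)
  from rPr0.prems have "rec_eval f xs y'" by (auto elim: rec_eval.cases)
  with rPr0.IH show ?case .
next
  case (rPrS f g n xs y z)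
  from rPrS.prems obtain v where "rec_eval (Pr f g) (n # xs) v" "rec_eval g (n # v # xs) y'"
    by (auto elim: rec_eval.cases)
  with rPrS.IH show ?case by metis
next
  case (rMn f n xs)
  from rMn.prems have y': "rec_eval f (y' # xs) 0" "\<forall>m<y'. \<exists>v. rec_eval f (m # xs) v \<and> 0 < v"
    by (auto elim: rec_eval.cases)
  have "\<not> y' < n" using rMn.IH(2) y'(1) by fastforce
  moreover have "\<not> n < y'" using rMn.IH(1) y'(2) by fastforce
  ultimately show ?case by simp
qed

definition unrefuted :: "nat \<Rightarrow> nat \<Rightarrow> nat \<Rightarrow> nat \<Rightarrow> nat \<Rightarrow> bool" where
  "unrefuted e n x y t \<longleftrightarrow>
     \<not> (\<exists>z<t. \<exists>W<t. derivation W \<and> judgement e (list_encode [n, x, y, z]) 0 \<in> set_decode W)"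

lemma decidable_unrefuted:
  assumes "computable a" "computable b" "computable c" "computable d" "computable e"
  shows "decidable (\<lambda>\<sigma>. unrefuted (a \<sigma>) (b \<sigma>) (c \<sigma>) (d \<sigma>) (e \<sigma>))"
proof (rule computable_app5[where F = "\<lambda>e n x y t. of_bool (unrefuted e n x y t)", OF _ assms])
  show "decidable (\<lambda>\<sigma>. unrefuted (\<sigma> 0) (\<sigma> 1) (\<sigma> 2) (\<sigma> 3) (\<sigma> 4))"
    unfolding unrefuted_def list_encode.simps
    by (intro computable_basic_intros decidable_set_decode computable_judgement computable_prod_encode
        decidable_derivation)
qed

lemma unrefuted_antimono: "unrefuted e n x y t \<Longrightarrow> t' \<le> t \<Longrightarrow> unrefuted e n x y t'"
  unfolding unrefuted_def by (meson less_le_trans)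

lemma unrefuted_iff_no_zero:
  "(\<forall>t. unrefuted (recf_encode p) n x y t) \<longleftrightarrow> (\<forall>z. \<not> rec_eval p [n, x, y, z] 0)"
proof -
  have "(\<exists>t. \<exists>z<t. \<exists>W<t. P z W) \<longleftrightarrow> (\<exists>z W. P z W)" for P :: "nat \<Rightarrow> nat \<Rightarrow> bool"
  proof
    assume "\<exists>z W. P z W"
    then obtain z W where "P z W" by blast
    moreover have "z < Suc (z + W)" "W < Suc (z + W)" by simp_all
    ultimately show "\<exists>t. \<exists>z<t. \<exists>W<t. P z W" by blast
  qed blast
  from this[of "\<lambda>z W. derivation W \<and> asserts W p [n, x, y, z] 0"] show ?thesis
    unfolding unrefuted_def rec_eval_iff_derivation asserts_def by blast
qed

lemma recursive_rel4_unrefutedE: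
  assumes "recursive_rel4 R"
  obtains e where "\<And>n x y. (\<forall>z. R n x y z) \<longleftrightarrow> (\<forall>t. unrefuted e n x y t)"
proof -
  obtain p where p: "\<And>n x y z. rec_eval p [n, x, y, z] (if R n x y z then 1 else 0)"
    using assms unfolding recursive_rel4_def by blast
  have "R n x y z \<longleftrightarrow> \<not> rec_eval p [n, x, y, z] 0" for n x y z
    using p[of n x y z] rec_eval_deterministic by (cases "R n x y z") fastforce+
  then have "(\<forall>z. R n x y z) \<longleftrightarrow> (\<forall>t. unrefuted (recf_encode p) n x y t)" for n x y
    by (simp add: unrefuted_iff_no_zero)
  then show ?thesis by (rule that)
qed

section \<open>Stacked binary expansions\<close>

lemma set_decode_eqI: "set_decode x = set_decode y \<Longrightarrow> x = y"
  by (metis set_decode_inverse)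

lemma set_decode_take_bit: "set_decode (take_bit t x) = set_decode x \<inter> {..<t}"
  by (auto simp: bit_take_bit_iff simp flip: bit_iff_set_decode)

lemma power_dvd_iff_set_decode: "2 ^ s dvd x \<longleftrightarrow> (\<forall>j\<in>set_decode x. s \<le> j)"
proof -
  have "2 ^ s dvd x \<longleftrightarrow> set_decode (take_bit s x) = set_decode 0"
    using set_decode_eqI by (auto simp flip: take_bit_eq_0_iff)
  then show ?thesis by (auto simp: set_decode_take_bit not_less disjoint_iff)
qed

lemma set_decode_ge: "2 ^ s dvd x \<Longrightarrow> j \<in> set_decode x \<Longrightarrow> s \<le> j"
  by (simp add: power_dvd_iff_set_decode)

lemma lowest_bit_exists:
  assumes "0 < x"
  obtains j where "j \<in> set_decode x" "2 ^ j dvd x"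
proof
  let ?j = "LEAST j. j \<in> set_decode x"
  have "set_decode x \<noteq> {}" using assms set_decode_eqI[of x 0] by auto
  then show "?j \<in> set_decode x" by (auto intro: LeastI)
  show "2 ^ ?j dvd x" by (auto simp: power_dvd_iff_set_decode intro: Least_le)
qed

lemma less_exp_Suc_floor_log: "x < 2 ^ Suc (floor_log x)"
  using floor_log_exp2_gt[of x] by simp

lemma le_floor_log: "2 ^ s \<le> x \<Longrightarrow> s \<le> floor_log x"
  using floor_log_mono[THEN monoD, of "2 ^ s" x] by simp

lemma less_floor_log_if_power_dvd: "2 ^ Suc i dvd x \<Longrightarrow> 0 < x \<Longrightarrow> i < floor_log x"
  using le_floor_log[OF dvd_imp_le, of "Suc i" x] by (simp add: Suc_le_eq)

lemma le_floor_log_if_set_decode: "j \<in> set_decode x \<Longrightarrow> j \<le> floor_log x"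
  using set_decode_less[OF _ less_exp_Suc_floor_log] by (simp add: less_Suc_eq_le)

lemma floor_log_in_set_decode: "0 < x \<Longrightarrow> floor_log x \<in> set_decode x"
proof -
  assume "0 < x"
  then have "x div 2 ^ floor_log x = 1"
    using floor_log_exp2_le[of x] floor_log_exp2_gt[of x] by (intro div_nat_eqI) auto
  then show ?thesis by (simp add: set_decode_def)
qed

definition stacked :: "nat \<Rightarrow> nat \<Rightarrow> bool" where
  "stacked n k \<longleftrightarrow> (\<exists>s. n < 2 ^ s \<and> 2 ^ s dvd k)"

lemma stackedI: "n < 2 ^ s \<Longrightarrow> 2 ^ s dvd k \<Longrightarrow> stacked n k"
  unfolding stacked_def by blast

lemma stackedI_floor_log: "2 ^ Suc (floor_log n) dvd k \<Longrightarrow> stacked n k"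
  using less_exp_Suc_floor_log by (rule stackedI)

lemma stacked_antimono: "stacked n k \<Longrightarrow> n' \<le> n \<Longrightarrow> stacked n' k"
  unfolding stacked_def using le_less_trans by blast

lemma stacked_less: "stacked n k \<Longrightarrow> i \<in> set_decode n \<Longrightarrow> j \<in> set_decode k \<Longrightarrow> i < j"
  unfolding stacked_def using set_decode_less set_decode_ge less_le_trans by blast

lemma set_decode_add_disjoint:
  assumes "set_decode n \<inter> set_decode k = {}"
  shows "set_decode (n + k) = set_decode n \<union> set_decode k"
proof -
  have "set_encode (set_decode n \<union> set_decode k) = set_encode (set_decode n) + set_encode (set_decode k)"
    using assms unfolding set_encode_def by (intro sum.union_disjoint) simp_all
  then have "set_encode (set_decode n \<union> set_decode k) = n + k" by simp
  then show ?thesis by (metis finite_Un finite_set_decode set_encode_inverse)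
qed

lemma set_decode_add_stacked: "stacked n k \<Longrightarrow> set_decode (n + k) = set_decode n \<union> set_decode k"
  using stacked_less by (intro set_decode_add_disjoint) blast

lemma stacked_add:
  assumes "stacked n k" "stacked n l"
  shows "stacked n (k + l)"
proof -
  obtain s s' where "n < 2 ^ s" "2 ^ s dvd k" "n < 2 ^ s'" "2 ^ s' dvd l"
    using assms unfolding stacked_def by blast
  then have "n < 2 ^ min s s'" "2 ^ min s s' dvd k" "2 ^ min s s' dvd l"
    by (simp_all add: min_def) (meson dvd_trans le_imp_power_dvd nat_le_linear)+
  then show ?thesis by (intro stackedI dvd_add)
qed

lemma stacked_take_bit:
  assumes "stacked n k"
  shows "stacked n (take_bit t k)"
proof -
  obtain s where "n < 2 ^ s" "2 ^ s dvd k" using assms unfolding stacked_def by blast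
  moreover from this(2) have "2 ^ s dvd take_bit t k"
    by (metis take_bit_eq_0_iff take_bit_of_0 take_bit_take_bit min.commute)
  ultimately show ?thesis by (intro stackedI)
qed

lemma take_bit_add_low:
  assumes "stacked n k" "t \<in> set_decode n"
  shows "take_bit t (n + k) = take_bit t n"
proof (rule set_decode_eqI)
  have "set_decode k \<inter> {..<t} = {}" using stacked_less[OF assms] by fastforce
  then show "set_decode (take_bit t (n + k)) = set_decode (take_bit t n)"
    by (simp add: set_decode_take_bit set_decode_add_stacked[OF assms(1)] Int_Un_distrib2)
qed

lemma take_bit_add_high:
  assumes "stacked n k" "t \<in> set_decode k"
  shows "take_bit t (n + k) = n + take_bit t k"
proof (rule set_decode_eqI)
  have "set_decode n \<inter> {..<t} = set_decode n" using stacked_less[OF assms(1) _ assms(2)] by blast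
  then show "set_decode (take_bit t (n + k)) = set_decode (n + take_bit t k)"
    by (simp add: set_decode_take_bit set_decode_add_stacked assms(1) stacked_take_bit Int_Un_distrib2)
qed

lemma less_exp_floor_log_if_stacked:
  assumes "stacked n k" "0 < k"
  shows "n < 2 ^ floor_log k"
proof -
  obtain s where s: "n < 2 ^ s" "2 ^ s dvd k" using assms(1) unfolding stacked_def by blast
  then have "s \<le> floor_log k" using assms(2) by (intro le_floor_log dvd_imp_le)
  then have "(2::nat) ^ s \<le> 2 ^ floor_log k" by simp
  with s(1) show ?thesis by (rule less_le_trans)
qed

lemma floor_log_add_stacked:
  assumes "stacked n k" "0 < k"
  shows "floor_log (n + k) = floor_log k"
proof (rule antisym)
  have "floor_log (n + k) \<in> set_decode n \<union> set_decode k"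
    using floor_log_in_set_decode[of "n + k"] assms by (simp add: set_decode_add_stacked)
  then show "floor_log (n + k) \<le> floor_log k"
  proof
    assume "floor_log (n + k) \<in> set_decode n"
    then show ?thesis
      using stacked_less[OF assms(1)] floor_log_in_set_decode[OF assms(2)] by (simp add: less_imp_le)
  next
    assume "floor_log (n + k) \<in> set_decode k"
    then show ?thesis by (rule le_floor_log_if_set_decode)
  qed
  show "floor_log k \<le> floor_log (n + k)" by (simp add: floor_log_le_iff)
qed

section \<open>Third differences of quadratic forms modulo 2\<close>

definition bit_val :: "nat \<Rightarrow> nat \<Rightarrow> nat" where
  "bit_val j x = of_bool (j \<in> set_decode x)"

definition pair_count :: "(nat \<Rightarrow> nat \<Rightarrow> bool) \<Rightarrow> nat \<Rightarrow> nat \<Rightarrow> nat" where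
  "pair_count C b x = (\<Sum>p'<b. \<Sum>p<p'. bit_val p' x * bit_val p x * of_bool (C p' p))"

definition quad_form :: "(nat \<Rightarrow> nat \<Rightarrow> nat \<Rightarrow> bool) \<Rightarrow> nat \<Rightarrow> nat" where
  "quad_form D x = pair_count (D (floor_log x)) (floor_log x) x"

definition cross_form :: "(nat \<Rightarrow> nat \<Rightarrow> bool) \<Rightarrow> nat \<Rightarrow> nat \<Rightarrow> nat" where
  "cross_form C m m' = (\<Sum>p'\<in>set_decode m'. \<Sum>p\<in>set_decode m. of_bool (C p' p))"

definition square_sum :: "nat \<Rightarrow> nat \<Rightarrow> (nat \<Rightarrow> nat) \<Rightarrow> nat" where
  "square_sum m m' f = f 0 + f m + f m' + f (m + m')"

definition cube_sum :: "nat \<Rightarrow> nat \<Rightarrow> nat \<Rightarrow> (nat \<Rightarrow> nat) \<Rightarrow> nat" where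
  "cube_sum m m' m'' f = square_sum m m' f + square_sum m m' (\<lambda>x. f (x + m''))"

lemma bit_val_add_stacked: "stacked n k \<Longrightarrow> bit_val j (n + k) = bit_val j n + bit_val j k"
  using stacked_less[of n k j j] by (auto simp: bit_val_def set_decode_add_stacked)

lemma square_sum_cong: "(\<And>x. x \<le> m + m' \<Longrightarrow> f x = g x) \<Longrightarrow> square_sum m m' f = square_sum m m' g"
  by (simp add: square_sum_def)

lemma square_sum_sum: "square_sum m m' (\<lambda>x. \<Sum>i\<in>I. f i x) = (\<Sum>i\<in>I. square_sum m m' (f i))"
  by (simp add: square_sum_def sum.distrib)

lemma cube_sum_const:
  assumes "\<And>i j l. i \<in> {0, m} \<Longrightarrow> j \<in> {0, m'} \<Longrightarrow> l \<in> {0, m''} \<Longrightarrow> f (i + j + l) = \<gamma>"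
  shows "cube_sum m m' m'' f = 8 * \<gamma>"
  using assms[of 0 0 0] assms[of m 0 0] assms[of 0 m' 0] assms[of m m' 0]
    assms[of 0 0 m''] assms[of m 0 m''] assms[of 0 m' m''] assms[of m m' m'']
  by (simp add: cube_sum_def square_sum_def)

lemma cube_sum_sum: "cube_sum m m' m'' (\<lambda>x. \<Sum>i\<in>I. f i x) = (\<Sum>i\<in>I. cube_sum m m' m'' (f i))"
  by (simp add: cube_sum_def square_sum_sum sum.distrib)

lemma cross_form_eq_sum_less:
  assumes "stacked m m'" "m' < 2 ^ b"
  shows "cross_form C m m' = (\<Sum>p'<b. \<Sum>p<p'. bit_val p m * bit_val p' m' * of_bool (C p' p))"
proof -
  have "(\<Sum>p\<in>set_decode m. of_bool (C p' p)) = (\<Sum>p<p'. bit_val p m * of_bool (C p' p) :: nat)"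
    if "p' \<in> set_decode m'" for p'
  proof (rule sum.mono_neutral_cong_left)
    show "set_decode m \<subseteq> {..<p'}" using stacked_less[OF assms(1) _ that] by blast
  qed (auto simp: bit_val_def)
  then have "cross_form C m m' = (\<Sum>p'\<in>set_decode m'. \<Sum>p<p'. bit_val p m * of_bool (C p' p))"
    by (simp add: cross_form_def)
  also have "\<dots> = (\<Sum>p'<b. \<Sum>p<p'. bit_val p m * bit_val p' m' * of_bool (C p' p))"
  proof (rule sum.mono_neutral_cong_left)
    show "set_decode m' \<subseteq> {..<b}" using set_decode_less[OF _ assms(2)] by blast
  qed (auto simp: bit_val_def)
  finally show ?thesis .
qed

lemma even_second_difference_mult:
  fixes x\<^sub>0 x\<^sub>1 x\<^sub>2 y\<^sub>0 y\<^sub>1 y\<^sub>2 :: nat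
  shows "even (x\<^sub>0 * y\<^sub>0 + (x\<^sub>1 + x\<^sub>0) * (y\<^sub>1 + y\<^sub>0) + (x\<^sub>2 + x\<^sub>0) * (y\<^sub>2 + y\<^sub>0) +
    (x\<^sub>1 + x\<^sub>2 + x\<^sub>0) * (y\<^sub>1 + y\<^sub>2 + y\<^sub>0) + x\<^sub>1 * y\<^sub>2 + x\<^sub>2 * y\<^sub>1)" (is "even ?s")
proof -
  have "?s = 2 * (2 * x\<^sub>0 * y\<^sub>0 + x\<^sub>0 * (y\<^sub>1 + y\<^sub>2) + (x\<^sub>1 + x\<^sub>2) * y\<^sub>0 + (x\<^sub>1 + x\<^sub>2) * (y\<^sub>1 + y\<^sub>2))"
    by algebra
  then show ?thesis by (rule dvdI)
qed

lemma even_square_sum_pair_count: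
  assumes "stacked m m'" "stacked (m + m') r" "m' < 2 ^ b"
  shows "even (square_sum m m' (\<lambda>x. pair_count C b (x + r)) + cross_form C m m')"
proof -
  have bit_val: "bit_val j (x + r) = bit_val j x + bit_val j r" if "x \<le> m + m'" for j x
    using bit_val_add_stacked stacked_antimono[OF assms(2) that] by blast
  have "even (square_sum m m' (\<lambda>x. bit_val p' (x + r) * bit_val p (x + r) * c) +
      bit_val p m * bit_val p' m' * c)" if "p < p'" for p p' c
  proof -
    let ?square = "square_sum m m' (\<lambda>x. bit_val p' (x + r) * bit_val p (x + r))"
    have cross_zero: "bit_val p' m * bit_val p m' = 0"
      using that stacked_less[OF assms(1), of p' p] by (auto simp: bit_val_def)
    have "even (?square + bit_val p m * bit_val p' m')"
      using even_second_difference_mult[of "bit_val p' r" "bit_val p r" "bit_val p' m" "bit_val p m"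
          "bit_val p' m'" "bit_val p m'", unfolded cross_zero]
      by (simp add: square_sum_def bit_val bit_val_add_stacked[OF assms(1)] mult.commute[of "bit_val p m"]
          del: even_add even_mult_iff)
    then have "even ((?square + bit_val p m * bit_val p' m') * c)" by (rule dvd_mult2)
    then show ?thesis by (simp only: square_sum_def distrib_right)
  qed
  then show ?thesis
    unfolding pair_count_def square_sum_sum cross_form_eq_sum_less[OF assms(1,3)] sum.distrib[symmetric]
    by (intro dvd_sum) simp
qed

lemma even_square_sum_quad_form:
  assumes "stacked m m'" "stacked (m + m') r" "0 < r"
  shows "even (square_sum m m' (\<lambda>x. quad_form D (x + r)) + cross_form (D (floor_log r)) m m')"
proof -
  let ?b = "floor_log r"
  have "square_sum m m' (\<lambda>x. quad_form D (x + r)) = square_sum m m' (\<lambda>x. pair_count (D ?b) ?b (x + r))"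
    using floor_log_add_stacked[OF stacked_antimono[OF assms(2)] assms(3)]
    by (intro square_sum_cong) (simp add: quad_form_def)
  moreover have "m' < 2 ^ ?b" using less_exp_floor_log_if_stacked[OF assms(2,3)] by simp
  ultimately show ?thesis
    using even_square_sum_pair_count[OF assms(1,2), of ?b "D ?b"] by simp
qed

definition table_coloring :: "(nat \<Rightarrow> nat \<Rightarrow> nat \<Rightarrow> nat \<Rightarrow> bool) \<Rightarrow> nat \<Rightarrow> nat" where
  "table_coloring D x = (\<Sum>t\<in>set_decode x. quad_form (D t) (take_bit t x)) mod 2"

definition defect :: "(nat \<Rightarrow> nat \<Rightarrow> nat \<Rightarrow> bool) \<Rightarrow> nat \<Rightarrow> nat \<Rightarrow> nat \<Rightarrow> nat" where
  "defect D a m m' = quad_form D m + quad_form D m' + quad_form D (m + m') + cross_form (D a) m m'"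

lemma quad_form_0 [simp]: "quad_form D 0 = 0"
  by (simp add: quad_form_def pair_count_def)

lemma table_coloring_0 [simp]: "table_coloring D 0 = 0"
  by (simp add: table_coloring_def)

lemma even_cube_sum_quad_form:
  assumes "stacked m m'" "stacked (m + m') m''" "stacked (m + m' + m'') r" "0 < r"
  shows "even (cube_sum m m' m'' (\<lambda>x. quad_form D (x + r)))"
proof -
  have "floor_log (m'' + r) = floor_log r"
    using stacked_antimono[OF assms(3)] assms(4) by (intro floor_log_add_stacked) simp_all
  moreover have "stacked (m + m') r" using stacked_antimono[OF assms(3)] by simp
  ultimately have "even (square_sum m m' (\<lambda>x. quad_form D (x + r)) + cross_form (D (floor_log r)) m m')"
    "even (square_sum m m' (\<lambda>x. quad_form D (x + (m'' + r))) + cross_form (D (floor_log r)) m m')"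
    using even_square_sum_quad_form[OF assms(1) _ assms(4)]
      even_square_sum_quad_form[OF assms(1) stacked_add[OF assms(2)], of r] assms(4) by simp_all
  then show ?thesis by (auto simp: cube_sum_def add.assoc)
qed

lemma even_cube_sum_quad_form_defect:
  assumes "stacked m m'" "stacked (m + m') m''" "0 < m''"
  shows "even (cube_sum m m' m'' (quad_form D) + defect D (floor_log m'') m m')"
  using even_square_sum_quad_form[OF assms, of D]
  by (simp add: cube_sum_def defect_def square_sum_def)

lemma even_table_coloring_add:
  assumes "stacked n k"
  shows "even (table_coloring D (n + k) + table_coloring D n +
    (\<Sum>t\<in>set_decode k. quad_form (D t) (n + take_bit t k)))"
proof -
  let ?sum = "\<lambda>x. \<Sum>t\<in>set_decode x. quad_form (D t) (take_bit t x)"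
  have "?sum (n + k) = ?sum n + (\<Sum>t\<in>set_decode k. quad_form (D t) (n + take_bit t k))"
  proof -
    have "set_decode n \<inter> set_decode k = {}" using stacked_less[OF assms] by blast
    then have "?sum (n + k) = (\<Sum>t\<in>set_decode n. quad_form (D t) (take_bit t (n + k))) +
        (\<Sum>t\<in>set_decode k. quad_form (D t) (take_bit t (n + k)))"
      unfolding set_decode_add_stacked[OF assms] by (intro sum.union_disjoint) simp_all
    then show ?thesis by (simp add: take_bit_add_low[OF assms] take_bit_add_high[OF assms])
  qed
  then show ?thesis by (auto simp: table_coloring_def)
qed

lemma even_cube_sum_table_coloring:
  assumes stacked: "stacked m m'" "stacked (m + m') m''" "stacked (m + m' + m'') k" and "0 < m''"
    and \<tau>: "\<tau> \<in> set_decode k" "2 ^ \<tau> dvd k"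
  shows "even (cube_sum m m' m'' (\<lambda>x. table_coloring D (x + k) + table_coloring D x) +
    defect (D \<tau>) (floor_log m'') m m')"
proof -
  define contribution where
    "contribution t = cube_sum m m' m'' (\<lambda>x. quad_form (D t) (x + take_bit t k))" for t
  have "even (cube_sum m m' m'' (\<lambda>x. table_coloring D (x + k) + table_coloring D x +
      (\<Sum>t\<in>set_decode k. quad_form (D t) (x + take_bit t k))))"
    unfolding cube_sum_def square_sum_def
    by (intro dvd_add even_table_coloring_add stacked_antimono[OF stacked(3)]) simp_all
  also have "\<dots> = cube_sum m m' m'' (\<lambda>x. table_coloring D (x + k) + table_coloring D x) +
      sum contribution (set_decode k)"
    unfolding contribution_def cube_sum_sum[symmetric] by (simp add: cube_sum_def square_sum_def)
  also have "sum contribution (set_decode k) = contribution \<tau> + sum contribution (set_decode k - {\<tau>})"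
    using \<tau>(1) by (intro sum.remove) simp_all
  finally have "even (cube_sum m m' m'' (\<lambda>x. table_coloring D (x + k) + table_coloring D x) +
      (contribution \<tau> + sum contribution (set_decode k - {\<tau>})))" .
  moreover have "even (sum contribution (set_decode k - {\<tau>}))"
  proof (rule dvd_sum)
    fix t assume "t \<in> set_decode k - {\<tau>}"
    then have "\<tau> < t" using set_decode_ge[OF \<tau>(2), of t] by simp
    then have "\<tau> \<in> set_decode (take_bit t k)" using \<tau>(1) by (simp add: set_decode_take_bit)
    then have "0 < take_bit t k" by (metis empty_iff gr0I set_decode_zero)
    then show "even (contribution t)"
      unfolding contribution_def using stacked by (intro even_cube_sum_quad_form stacked_take_bit)
  qed
  moreover have "even (contribution \<tau> + defect (D \<tau>) (floor_log m'') m m')"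
  proof -
    have "take_bit \<tau> k = 0" using \<tau>(2) by (simp only: take_bit_eq_0_iff)
    then show ?thesis
      using even_cube_sum_quad_form_defect[OF stacked(1,2) assms(4)] by (simp add: contribution_def)
  qed
  ultimately show ?thesis by simp
qed

lemma even_defect_if_cube_monochromatic:
  assumes "stacked m m'" "stacked (m + m') m''" "stacked (m + m' + m'') k"
    and "0 < m" "0 < m'" "0 < m''" "\<tau> \<in> set_decode k" "2 ^ \<tau> dvd k"
    and monochromatic: "\<And>i j l h. i \<in> {0, m} \<Longrightarrow> j \<in> {0, m'} \<Longrightarrow> l \<in> {0, m''} \<Longrightarrow> h \<in> {0, k} \<Longrightarrow>
      0 < i + j + l + h \<Longrightarrow> table_coloring D (i + j + l + h) = \<gamma>"
  shows "even (\<gamma> + defect (D \<tau>) (floor_log m'') m m')"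
proof -
  have "0 < k" using assms(7) by (metis empty_iff gr0I set_decode_zero)
  then have "cube_sum m m' m'' (\<lambda>x. table_coloring D (x + k)) = 8 * \<gamma>"
    using monochromatic[of _ _ _ k] by (intro cube_sum_const) simp
  moreover have "cube_sum m m' m'' (\<lambda>x. if x = 0 then \<gamma> else table_coloring D x) = 8 * \<gamma>"
    using monochromatic[of _ _ _ 0] by (intro cube_sum_const) simp
  then have "cube_sum m m' m'' (table_coloring D) + \<gamma> = 8 * \<gamma>"
    using assms(4-6) by (simp add: cube_sum_def square_sum_def)
  moreover have "cube_sum m m' m'' (\<lambda>x. table_coloring D (x + k) + table_coloring D x) =
      cube_sum m m' m'' (\<lambda>x. table_coloring D (x + k)) + cube_sum m m' m'' (table_coloring D)"
    by (simp add: cube_sum_def square_sum_def)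
  ultimately have "cube_sum m m' m'' (\<lambda>x. table_coloring D (x + k) + table_coloring D x) = 15 * \<gamma>"
    by linarith
  then show ?thesis
    using even_cube_sum_table_coloring[OF assms(1-3,6-8), of D] by simp
qed

lemma cross_form_change_top:
  assumes "0 < m" "0 < m'"
    and agree: "\<And>q' q. q' \<in> set_decode m' \<Longrightarrow> q \<in> set_decode m \<Longrightarrow>
      q' < floor_log m' \<or> q' = floor_log m' \<and> q < floor_log m \<Longrightarrow> C q' q = C\<^sub>0 q' q"
    and "\<not> C\<^sub>0 (floor_log m') (floor_log m)"
  shows "cross_form C m m' = cross_form C\<^sub>0 m m' + of_bool (C (floor_log m') (floor_log m))"
proof -
  let ?pairs = "set_decode m' \<times> set_decode m" and ?top = "(floor_log m', floor_log m)"
  have remove_top: "cross_form B m m' =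
      of_bool (case_prod B ?top) + (\<Sum>z\<in>?pairs - {?top}. of_bool (case_prod B z))" for B
  proof -
    have "cross_form B m m' = (\<Sum>z\<in>?pairs. of_bool (case_prod B z))"
      unfolding cross_form_def sum.cartesian_product by (intro sum.cong) auto
    also have "\<dots> = of_bool (case_prod B ?top) + (\<Sum>z\<in>?pairs - {?top}. of_bool (case_prod B z))"
      using assms(1,2) by (intro sum.remove) (simp_all add: floor_log_in_set_decode)
    finally show ?thesis .
  qed
  have "case_prod C z = case_prod C\<^sub>0 z" if "z \<in> ?pairs - {?top}" for z
  proof -
    obtain q' q where z: "z = (q', q)" by (cases z)
    have "C q' q = C\<^sub>0 q' q"
      using that le_floor_log_if_set_decode[of q' m'] le_floor_log_if_set_decode[of q m]
      by (intro agree) (auto simp: z)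
    then show ?thesis by (simp add: z)
  qed
  then show ?thesis using assms(4) by (simp add: remove_top)
qed

lemma defect_change_top:
  assumes "stacked m m'" "0 < m" "0 < m'" "floor_log m' < a"
    and agree: "\<And>b q' q. q < q' \<Longrightarrow> q' < b \<Longrightarrow>
      b < a \<or> b = a \<and> (q' < floor_log m' \<or> q' = floor_log m' \<and> q < floor_log m) \<Longrightarrow> D b q' q = D\<^sub>0 b q' q"
    and "\<not> D\<^sub>0 a (floor_log m') (floor_log m)"
  shows "defect D a m m' = defect D\<^sub>0 a m m' + of_bool (D a (floor_log m') (floor_log m))"
proof -
  have "quad_form D x = quad_form D\<^sub>0 x" if "floor_log x < a" for x
    using that agree unfolding quad_form_def pair_count_def by (intro sum.cong) simp_all
  moreover have "floor_log m < floor_log m'"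
    using assms(1-3) floor_log_in_set_decode stacked_less by blast
  then have "floor_log m < a" "floor_log (m + m') < a"
    using assms(4) floor_log_add_stacked[OF assms(1,3)] by simp_all
  moreover have "cross_form (D a) m m' =
      cross_form (D\<^sub>0 a) m m' + of_bool (D a (floor_log m') (floor_log m))"
    using assms(2,3)
  proof (rule cross_form_change_top)
    fix q' q assume "q' \<in> set_decode m'" "q \<in> set_decode m"
      and "q' < floor_log m' \<or> q' = floor_log m' \<and> q < floor_log m"
    then show "D a q' q = D\<^sub>0 a q' q"
      using stacked_less[OF assms(1)] assms(4) by (intro agree) auto
  qed fact
  ultimately show ?thesis using assms(4) by (simp add: defect_def)
qed

section \<open>The coloring\<close>

definition level :: "(nat \<Rightarrow> nat \<Rightarrow> nat \<Rightarrow> bool) \<Rightarrow> nat set \<Rightarrow> nat \<Rightarrow> nat" where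
  "level Q F a = card {u. u < a \<and> (\<forall>n\<in>F. \<forall>x\<le>u. \<exists>y<a. Q n x y)}"

text \<open>An index \<open>e\<close> stands for the \<open>\<Pi>\<^sup>0\<^sub>3\<close> set with program \<open>e div 2\<close>, together with the guess \<open>e mod 2\<close>
  for the colour of a solution. As \<open>t\<close> grows the level converges, and its limit is unbounded in \<open>a\<close> if and only
  if the finite set coded by \<open>F\<close> is contained in the \<open>\<Pi>\<^sup>0\<^sub>3\<close> set.\<close>

definition stage_level :: "nat \<Rightarrow> nat \<Rightarrow> nat \<Rightarrow> nat \<Rightarrow> nat" where
  "stage_level e F a t = level (\<lambda>n x y. unrefuted (e div 2) n x y t) (set_decode F) a"

definition code_sum :: "nat \<Rightarrow> nat" where
  "code_sum F = \<Sum>(set_decode F)"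

definition low_candidate :: "nat \<Rightarrow> nat \<Rightarrow> bool" where
  "low_candidate p F \<longleftrightarrow> 0 < code_sum F \<and> floor_log (code_sum F) = p"

text \<open>The last condition says that the elements of the coded set are at least \<open>2 ^ Suc p\<close>, which makes the set
  disjoint from every low candidate.\<close>

definition high_candidate :: "nat \<Rightarrow> nat \<Rightarrow> nat \<Rightarrow> bool" where
  "high_candidate p p' F \<longleftrightarrow> low_candidate p' F \<and> 2 ^ Suc p dvd code_sum F \<and> 2 ^ 2 ^ Suc p dvd F"

definition rises :: "nat \<Rightarrow> nat \<Rightarrow> nat \<Rightarrow> nat \<Rightarrow> nat \<Rightarrow> bool" where
  "rises e p p' a t \<longleftrightarrow> e \<le> p \<and>
     (\<exists>F<2 ^ 2 ^ Suc p. low_candidate p F \<and> stage_level e F p' t < stage_level e F a t)"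

text \<open>Each index claims at most \<open>2 ^ e\<close> positions, so the smaller indices together leave it at least one.\<close>

definition served :: "nat \<Rightarrow> nat \<Rightarrow> nat \<Rightarrow> nat \<Rightarrow> nat" where
  "served p p' a t =
     bounded_Least (Suc p) (\<lambda>e. rises e p p' a t \<and> card {q. q < p \<and> rises e q p' a t} < 2 ^ e)"

definition highest_code :: "(nat \<Rightarrow> bool) \<Rightarrow> nat \<Rightarrow> nat \<Rightarrow> nat \<Rightarrow> nat \<Rightarrow> nat" where
  "highest_code C N e a t =
     bounded_Least N (\<lambda>F. C F \<and> (\<forall>G<N. C G \<longrightarrow> stage_level e G a t \<le> stage_level e F a t))"

definition low_code :: "nat \<Rightarrow> nat \<Rightarrow> nat \<Rightarrow> nat \<Rightarrow> nat" where
  "low_code p p' a t = highest_code (low_candidate p) (2 ^ 2 ^ Suc p) (served p p' a t) a t"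

definition high_code :: "nat \<Rightarrow> nat \<Rightarrow> nat \<Rightarrow> nat \<Rightarrow> nat" where
  "high_code p p' a t = highest_code (high_candidate p p') (2 ^ 2 ^ Suc p') (served p p' a t) a t"

text \<open>On triples \<open>a > p' > p\<close> the order of these indices is the lexicographic one.\<close>

definition triple_index :: "nat \<Rightarrow> nat \<Rightarrow> nat \<Rightarrow> nat" where
  "triple_index a p' p = 2 ^ a + 2 ^ p' + 2 ^ p"

definition clear_top_bit :: "nat \<Rightarrow> nat" where
  "clear_top_bit x = x - 2 ^ floor_log x"

definition decoded_coefficient :: "nat \<Rightarrow> nat \<Rightarrow> nat \<Rightarrow> nat \<Rightarrow> bool" where
  "decoded_coefficient W a p' p \<longleftrightarrow> triple_index a p' p \<in> set_decode W"

text \<open>A solution of colour \<open>\<gamma>\<close> makes \<open>\<gamma>\<close> plus the defect even. The new coefficient occurs exactly once in the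
  defect, and it is chosen to make this sum odd. Only the parity of the served index matters.\<close>

definition new_coefficient :: "nat \<Rightarrow> nat \<Rightarrow> nat \<Rightarrow> nat \<Rightarrow> nat \<Rightarrow> bool" where
  "new_coefficient t W a p' p \<longleftrightarrow> even (served p p' a t +
     defect (decoded_coefficient W) a (code_sum (low_code p p' a t)) (code_sum (high_code p p' a t)))"

definition bit_rec :: "(nat \<Rightarrow> nat \<Rightarrow> bool) \<Rightarrow> nat \<Rightarrow> nat" where
  "bit_rec B n = rec_nat 0 (\<lambda>j W. W + of_bool (B j W) * 2 ^ j) n"

definition table :: "nat \<Rightarrow> nat \<Rightarrow> nat" where
  "table t = bit_rec (\<lambda>j W. new_coefficient t W (floor_log j) (floor_log (clear_top_bit j))
     (floor_log (clear_top_bit (clear_top_bit j))))"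

definition coefficient :: "nat \<Rightarrow> nat \<Rightarrow> nat \<Rightarrow> nat \<Rightarrow> bool" where
  "coefficient t = decoded_coefficient (table t (2 ^ t))"

definition coloring :: "nat \<Rightarrow> nat" where
  "coloring = table_coloring coefficient"

subsection \<open>Computability\<close>

lemma computable_stage_level:
  assumes "computable a" "computable b" "computable c" "computable d"
  shows "computable (\<lambda>\<sigma>. stage_level (a \<sigma>) (b \<sigma>) (c \<sigma>) (d \<sigma>))"
proof (rule computable_app4[where F = stage_level, OF _ assms])
  show "computable (\<lambda>\<sigma>. stage_level (\<sigma> 0) (\<sigma> 1) (\<sigma> 2) (\<sigma> 3))"
    unfolding stage_level_def level_def
    by (intro computable_basic_intros decidable_ball_set_decode decidable_unrefuted)
qed

lemma computable_code_sum:
  assumes "computable a"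
  shows "computable (\<lambda>\<sigma>. code_sum (a \<sigma>))"
proof (rule computable_app1[OF _ assms])
  show "computable (\<lambda>\<sigma>. code_sum (\<sigma> 0))"
    unfolding code_sum_def by (intro computable_sum_set_decode computable_var)
qed

lemma decidable_low_candidate:
  assumes "computable a" "computable b"
  shows "decidable (\<lambda>\<sigma>. low_candidate (a \<sigma>) (b \<sigma>))"
  unfolding low_candidate_def by (intro computable_basic_intros computable_floor_log computable_code_sum assms)

lemma decidable_high_candidate:
  assumes "computable a" "computable b" "computable c"
  shows "decidable (\<lambda>\<sigma>. high_candidate (a \<sigma>) (b \<sigma>) (c \<sigma>))"
  unfolding high_candidate_def
  by (intro computable_basic_intros decidable_low_candidate computable_code_sum assms)

lemma decidable_rises:
  assumes "computable a" "computable b" "computable c" "computable d" "computable e"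
  shows "decidable (\<lambda>\<sigma>. rises (a \<sigma>) (b \<sigma>) (c \<sigma>) (d \<sigma>) (e \<sigma>))"
proof (rule computable_app5[where F = "\<lambda>e p p' a t. of_bool (rises e p p' a t)", OF _ assms])
  show "decidable (\<lambda>\<sigma>. rises (\<sigma> 0) (\<sigma> 1) (\<sigma> 2) (\<sigma> 3) (\<sigma> 4))"
    unfolding rises_def by (intro computable_basic_intros decidable_low_candidate computable_stage_level)
qed

lemma computable_served:
  assumes "computable a" "computable b" "computable c" "computable d"
  shows "computable (\<lambda>\<sigma>. served (a \<sigma>) (b \<sigma>) (c \<sigma>) (d \<sigma>))"
proof (rule computable_app4[where F = served, OF _ assms])
  show "computable (\<lambda>\<sigma>. served (\<sigma> 0) (\<sigma> 1) (\<sigma> 2) (\<sigma> 3))"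
    unfolding served_def by (intro computable_basic_intros decidable_rises)
qed

lemma computable_low_code:
  assumes "computable a" "computable b" "computable c" "computable d"
  shows "computable (\<lambda>\<sigma>. low_code (a \<sigma>) (b \<sigma>) (c \<sigma>) (d \<sigma>))"
proof (rule computable_app4[where F = low_code, OF _ assms])
  show "computable (\<lambda>\<sigma>. low_code (\<sigma> 0) (\<sigma> 1) (\<sigma> 2) (\<sigma> 3))"
    unfolding low_code_def highest_code_def
    by (intro computable_basic_intros decidable_low_candidate computable_stage_level computable_served)
qed

lemma computable_high_code:
  assumes "computable a" "computable b" "computable c" "computable d"
  shows "computable (\<lambda>\<sigma>. high_code (a \<sigma>) (b \<sigma>) (c \<sigma>) (d \<sigma>))"
proof (rule computable_app4[where F = high_code, OF _ assms])
  show "computable (\<lambda>\<sigma>. high_code (\<sigma> 0) (\<sigma> 1) (\<sigma> 2) (\<sigma> 3))"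
    unfolding high_code_def highest_code_def
    by (intro computable_basic_intros decidable_high_candidate computable_stage_level computable_served)
qed

lemma decidable_decoded_coefficient:
  assumes "computable a" "computable b" "computable c" "computable d"
  shows "decidable (\<lambda>\<sigma>. decoded_coefficient (a \<sigma>) (b \<sigma>) (c \<sigma>) (d \<sigma>))"
  unfolding decoded_coefficient_def triple_index_def
  by (intro computable_basic_intros decidable_set_decode assms)

lemma computable_quad_form:
  assumes "computable a" "computable b"
  shows "computable (\<lambda>\<sigma>. quad_form (decoded_coefficient (a \<sigma>)) (b \<sigma>))"
proof (rule computable_app2[where F = "\<lambda>W. quad_form (decoded_coefficient W)", OF _ assms])
  show "computable (\<lambda>\<sigma>. quad_form (decoded_coefficient (\<sigma> 0)) (\<sigma> 1))"
    unfolding quad_form_def pair_count_def bit_val_def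
    by (intro computable_basic_intros decidable_set_decode computable_floor_log decidable_decoded_coefficient)
qed

lemma computable_cross_form:
  assumes "computable a" "computable b" "computable c" "computable d"
  shows "computable (\<lambda>\<sigma>. cross_form (decoded_coefficient (a \<sigma>) (b \<sigma>)) (c \<sigma>) (d \<sigma>))"
proof (rule computable_app4[where F = "\<lambda>W a. cross_form (decoded_coefficient W a)", OF _ assms])
  show "computable (\<lambda>\<sigma>. cross_form (decoded_coefficient (\<sigma> 0) (\<sigma> 1)) (\<sigma> 2) (\<sigma> 3))"
    unfolding cross_form_def
    by (intro computable_sum_set_decode decidable_decoded_coefficient computable_var)
qed

lemma decidable_new_coefficient:
  assumes "computable a" "computable b" "computable c" "computable d" "computable e"
  shows "decidable (\<lambda>\<sigma>. new_coefficient (a \<sigma>) (b \<sigma>) (c \<sigma>) (d \<sigma>) (e \<sigma>))"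
  unfolding new_coefficient_def defect_def
  by (intro computable_basic_intros computable_quad_form computable_cross_form computable_served
      computable_low_code computable_high_code computable_code_sum assms)

lemma computable_bit_rec:
  assumes "decidable (\<lambda>\<tau>. B (\<tau> 0) (\<tau> 1) (\<lambda>j. \<tau> (Suc (Suc j))))" "computable k"
  shows "computable (\<lambda>\<sigma>. bit_rec (\<lambda>j W. B j W \<sigma>) (k \<sigma>))"
  unfolding bit_rec_def
  by (rule computable_rec_nat[where h = "\<lambda>j W \<sigma>. W + of_bool (B j W \<sigma>) * 2 ^ j"])
    (intro computable_basic_intros assms)+

lemma computable_clear_top_bit:
  assumes "computable a"
  shows "computable (\<lambda>\<sigma>. clear_top_bit (a \<sigma>))"
  unfolding clear_top_bit_def by (intro computable_basic_intros computable_floor_log assms)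

lemma computable_table:
  assumes "computable a" "computable b"
  shows "computable (\<lambda>\<sigma>. table (a \<sigma>) (b \<sigma>))"
proof (rule computable_app2[OF _ assms])
  show "computable (\<lambda>\<sigma>. table (\<sigma> 0) (\<sigma> 1))"
    unfolding table_def
    by (intro computable_bit_rec decidable_new_coefficient computable_floor_log computable_clear_top_bit
        computable_var)
qed

lemma recursive1_coloring: "recursive1 coloring"
proof (rule recursive1I)
  show "computable (\<lambda>\<sigma>. coloring (\<sigma> 0))"
    unfolding coloring_def table_coloring_def coefficient_def
    by (intro computable_basic_intros computable_sum_set_decode computable_quad_form computable_table
        computable_take_bit)
qed

subsection \<open>The table\<close>

lemma set_decode_bit_rec: "j \<in> set_decode (bit_rec B n) \<longleftrightarrow> j < n \<and> B j (bit_rec B j)"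
proof (induction n arbitrary: j)
  case 0
  show ?case by (simp add: bit_rec_def)
next
  case (Suc n)
  have step: "bit_rec B (Suc n) = of_bool (B n (bit_rec B n)) * 2 ^ n + bit_rec B n"
    by (simp add: bit_rec_def)
  have "n \<notin> set_decode (bit_rec B n)" using Suc.IH by simp
  then have "set_decode (bit_rec B (Suc n)) = set_decode (bit_rec B n) \<union> {j. j = n \<and> B n (bit_rec B n)}"
    by (auto simp: step set_decode_plus_power_2)
  then show ?case using Suc.IH[of j] by (auto simp: less_Suc_eq)
qed

lemma clear_top_bit_power_add:
  assumes "r < 2 ^ a"
  shows "floor_log (2 ^ a + r) = a" "clear_top_bit (2 ^ a + r) = r"
proof -
  show "floor_log (2 ^ a + r) = a" using assms by (intro floor_log_eqI) auto
  then show "clear_top_bit (2 ^ a + r) = r" by (simp add: clear_top_bit_def)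
qed

lemma power_add_power_less:
  assumes "p < p'" "p' < a"
  shows "(2::nat) ^ p' + 2 ^ p < 2 ^ a"
proof -
  have "(2::nat) ^ p < 2 ^ p'" using assms(1) by simp
  moreover have "(2::nat) ^ Suc p' \<le> 2 ^ a" using assms(2) by (intro power_increasing) simp_all
  ultimately show ?thesis unfolding power_Suc by linarith
qed

lemma triple_index_less_power:
  assumes "p < p'" "p' < a" "a < t"
  shows "triple_index a p' p < 2 ^ t"
proof -
  have "triple_index a p' p < 2 ^ Suc a"
    using power_add_power_less[OF assms(1,2)] by (simp add: triple_index_def)
  also have "(2::nat) ^ Suc a \<le> 2 ^ t" using assms(3) by (intro power_increasing) simp_all
  finally show ?thesis .
qed

lemma triple_index_less:
  assumes "q < q'" "q' < b" "b < a \<or> b = a \<and> (q' < p' \<or> q' = p' \<and> q < p)"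
  shows "triple_index b q' q < triple_index a p' p"
proof -
  consider "b < a" | "b = a" "q' < p'" | "b = a" "q' = p'" "q < p" using assms(3) by blast
  then show ?thesis
  proof cases
    case 1
    then show ?thesis
      using triple_index_less_power[OF assms(1,2)] by (simp add: triple_index_def[of a] trans_less_add1)
  next
    case 2
    then show ?thesis using power_add_power_less[OF assms(1)] by (simp add: triple_index_def trans_less_add1)
  next
    case 3
    then show ?thesis by (simp add: triple_index_def)
  qed
qed

lemma coefficient_iff_new_coefficient:
  assumes "p < p'" "p' < a" "a < t"
  shows "coefficient t a p' p \<longleftrightarrow> new_coefficient t (table t (triple_index a p' p)) a p' p"
proof -
  let ?j = "triple_index a p' p"
  have "?j = 2 ^ a + (2 ^ p' + 2 ^ p)" by (simp add: triple_index_def)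
  with power_add_power_less[OF assms(1,2)]
  have "floor_log ?j = a" "clear_top_bit ?j = 2 ^ p' + 2 ^ p" by (simp_all only: clear_top_bit_power_add)
  moreover have "floor_log (2 ^ p' + 2 ^ p) = p'" "clear_top_bit (2 ^ p' + 2 ^ p) = 2 ^ p"
    using assms(1) by (simp_all add: clear_top_bit_power_add)
  ultimately show ?thesis
    using triple_index_less_power[OF assms]
    by (simp add: coefficient_def decoded_coefficient_def table_def set_decode_bit_rec)
qed

lemma odd_defect_coefficient:
  assumes "p < p'" "p' < a" "a < t"
    and low: "low_candidate p (low_code p p' a t)" and high: "high_candidate p p' (high_code p p' a t)"
  shows "odd (served p p' a t +
    defect (coefficient t) a (code_sum (low_code p p' a t)) (code_sum (high_code p p' a t)))"
proof -
  define m where "m = code_sum (low_code p p' a t)"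
  define m' where "m' = code_sum (high_code p p' a t)"
  have m: "0 < m" "floor_log m = p" "0 < m'" "floor_log m' = p'" "2 ^ Suc p dvd m'"
    using low high by (simp_all add: m_def m'_def low_candidate_def high_candidate_def)
  have "stacked m m'" using m(2,5) by (intro stackedI_floor_log) simp
  define D\<^sub>0 where "D\<^sub>0 = decoded_coefficient (table t (triple_index a p' p))"
  have "defect (coefficient t) a m m' = defect D\<^sub>0 a m m' + of_bool (coefficient t a p' p)"
    unfolding m(2,4)[symmetric]
  proof (rule defect_change_top)
    fix b q' q
    assume "q < q'" "q' < b"
      "b < a \<or> b = a \<and> (q' < floor_log m' \<or> q' = floor_log m' \<and> q < floor_log m)"
    then have "triple_index b q' q < triple_index a p' p"
      using m(2,4) by (intro triple_index_less) simp_all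
    moreover have "triple_index a p' p < 2 ^ t" using assms by (intro triple_index_less_power)
    ultimately show "coefficient t b q' q = D\<^sub>0 b q' q"
      by (simp add: coefficient_def D\<^sub>0_def decoded_coefficient_def table_def set_decode_bit_rec)
  qed (use \<open>stacked m m'\<close> m assms(2) in
    \<open>simp_all add: D\<^sub>0_def decoded_coefficient_def table_def set_decode_bit_rec\<close>)
  moreover have "coefficient t a p' p \<longleftrightarrow> even (served p p' a t + defect D\<^sub>0 a m m')"
    using coefficient_iff_new_coefficient[OF assms(1-3)] by (simp add: new_coefficient_def D\<^sub>0_def m_def m'_def)
  ultimately show ?thesis by (auto simp flip: m_def m'_def)
qed

section \<open>Limits of the approximations\<close>

lemma eventually_sequentiallyE:
  assumes "eventually P sequentially"
  obtains N where "\<And>n. N \<le> n \<Longrightarrow> P n"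
  using assms unfolding eventually_sequentially by blast

lemma level_le: "level Q F a \<le> a"
  unfolding level_def using card_mono[of "{..<a}"] by (simp add: subset_iff)

lemma level_mono: "a \<le> b \<Longrightarrow> level Q F a \<le> level Q F b"
  unfolding level_def by (rule card_mono) (auto, meson less_le_trans)

lemma level_bounded:
  assumes "\<not> F \<subseteq> {n. \<forall>x. \<exists>y. Q n x y}"
  obtains K where "\<And>a. level Q F a \<le> K"
proof -
  obtain n x where "n \<in> F" "\<And>y. \<not> Q n x y" using assms by blast
  then have "{u. u < a \<and> (\<forall>n\<in>F. \<forall>x\<le>u. \<exists>y<a. Q n x y)} \<subseteq> {..<x}" for a
    by (auto simp: not_less[symmetric])
  then have "level Q F a \<le> x" for a
    unfolding level_def using card_mono[OF finite_lessThan, of _ x] by simp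
  then show ?thesis by (rule that)
qed

lemma level_eventually_const:
  assumes "\<not> F \<subseteq> {n. \<forall>x. \<exists>y. Q n x y}"
  shows "\<forall>\<^sub>F b in sequentially. \<forall>a\<ge>b. level Q F a = level Q F b"
proof -
  obtain K where "\<And>a. level Q F a \<le> K" using level_bounded[OF assms] by blast
  then obtain N where "\<forall>a. level Q F a \<le> level Q F N"
    using ex_has_greatest_nat[of "\<lambda>_. True" _ "level Q F" "Suc K"] by (auto simp: less_Suc_eq_le)
  then have "level Q F a = level Q F N" if "N \<le> a" for a
    using level_mono[OF that, of Q F] by (simp add: antisym)
  then show ?thesis unfolding eventually_sequentially by (metis order_trans)
qed

lemma level_unbounded:
  assumes "finite F" "F \<subseteq> {n. \<forall>x. \<exists>y. Q n x y}"
  shows "\<forall>\<^sub>F a in sequentially. K < level Q F a"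
proof -
  have "\<forall>n\<in>F. \<forall>x. \<exists>y. Q n x y" using assms(2) by blast
  then obtain y where y: "\<And>n x. n \<in> F \<Longrightarrow> Q n x (y n x)" by metis
  have "\<forall>\<^sub>F a in sequentially. \<forall>n\<in>F. \<forall>x\<in>{..K}. y n x < a"
    using assms(1) by (intro eventually_ball_finite ballI eventually_gt_at_top) simp_all
  with eventually_gt_at_top[of K] show ?thesis
  proof eventually_elim
    case (elim a)
    have "{..K} \<subseteq> {u. u < a \<and> (\<forall>n\<in>F. \<forall>x\<le>u. \<exists>y<a. Q n x y)}"
    proof (intro subsetI CollectI)
      fix u assume "u \<in> {..K}"
      then have "\<exists>z<a. Q n x z" if "n \<in> F" "x \<le> u" for n x
        using elim y that by (intro exI[of _ "y n x"]) simp
      then show "u < a \<and> (\<forall>n\<in>F. \<forall>x\<le>u. \<exists>y<a. Q n x y)"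
        using elim \<open>u \<in> {..K}\<close> by simp
    qed
    then have "card {..K} \<le> level Q F a" unfolding level_def by (intro card_mono) simp_all
    then show ?case by simp
  qed
qed

lemma level_eventually_eq:
  assumes "finite F" "\<And>n x y. \<forall>\<^sub>F t in net. Q t n x y \<longleftrightarrow> Q' n x y"
  shows "\<forall>\<^sub>F t in net. level (Q t) F a = level Q' F a"
proof -
  have "\<forall>\<^sub>F t in net. \<forall>n\<in>F. \<forall>x\<in>{..<a}. \<forall>y\<in>{..<a}. Q t n x y \<longleftrightarrow> Q' n x y"
    using assms by (intro eventually_ball_finite ballI) simp_all
  then show ?thesis
  proof eventually_elim
    case (elim t)
    then have "(\<forall>n\<in>F. \<forall>x\<le>u. \<exists>y<a. Q t n x y) \<longleftrightarrow> (\<forall>n\<in>F. \<forall>x\<le>u. \<exists>y<a. Q' n x y)" if "u < a" for u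
      using that by (meson le_less_trans lessThan_iff)
    then show ?case unfolding level_def by (intro arg_cong[of _ _ card]) blast
  qed
qed

definition index_set :: "nat \<Rightarrow> nat set" where
  "index_set e = {n. \<forall>x. \<exists>y. \<forall>t. unrefuted (e div 2) n x y t}"

definition limit_level :: "nat \<Rightarrow> nat \<Rightarrow> nat \<Rightarrow> nat" where
  "limit_level e F a = level (\<lambda>n x y. \<forall>t. unrefuted (e div 2) n x y t) (set_decode F) a"

lemma stage_level_limit: "\<forall>\<^sub>F t in sequentially. stage_level e F a t = limit_level e F a"
  unfolding stage_level_def limit_level_def
proof (rule level_eventually_eq)
  fix n x y
  show "\<forall>\<^sub>F t in sequentially. unrefuted (e div 2) n x y t \<longleftrightarrow> (\<forall>t. unrefuted (e div 2) n x y t)"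
  proof (cases "\<forall>t. unrefuted (e div 2) n x y t")
    case False
    then obtain N where "\<not> unrefuted (e div 2) n x y N" by blast
    then have "\<forall>t\<ge>N. \<not> unrefuted (e div 2) n x y t" using unrefuted_antimono by blast
    then show ?thesis unfolding eventually_sequentially by blast
  qed simp
qed simp

lemma stage_level_limit_all:
  "\<forall>\<^sub>F t in sequentially. \<forall>F\<in>{..<N}. stage_level e F a t = limit_level e F a"
  by (intro eventually_ball_finite ballI stage_level_limit) simp

lemma le_code_sum: "n \<in> set_decode F \<Longrightarrow> n \<le> code_sum F"
  unfolding code_sum_def by (rule member_le_sum) simp_all

lemma less_power_if_code_sum_less:
  assumes "code_sum F < n"
  shows "F < 2 ^ n"
proof -
  have "F = set_encode (set_decode F)" by simp
  also have "\<dots> \<le> (\<Sum>i<n. 2 ^ i)" unfolding set_encode_def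
    using le_code_sum le_less_trans[OF _ assms] by (intro sum_mono2) auto
  also have "\<dots> < 2 ^ n" by (induction n) auto
  finally show ?thesis .
qed

lemma low_candidate_less:
  assumes "low_candidate p F"
  shows "code_sum F < 2 ^ Suc p" "F < 2 ^ 2 ^ Suc p"
proof -
  show "code_sum F < 2 ^ Suc p"
    using less_exp_Suc_floor_log[of "code_sum F"] assms by (simp add: low_candidate_def)
  then show "F < 2 ^ 2 ^ Suc p" by (rule less_power_if_code_sum_less)
qed

definition positions :: "nat \<Rightarrow> nat set" where
  "positions e = {p. e \<le> p \<and> (\<exists>F. low_candidate p F \<and> set_decode F \<subseteq> index_set e)}"

lemma rises_limit_if_position:
  assumes "p \<in> positions e"
  shows "\<forall>\<^sub>F a in sequentially. \<forall>\<^sub>F t in sequentially. rises e p p' a t"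
proof -
  obtain F where F: "low_candidate p F" "set_decode F \<subseteq> index_set e" and "e \<le> p"
    using assms unfolding positions_def by blast
  have "\<forall>\<^sub>F a in sequentially. limit_level e F p' < limit_level e F a"
    using F(2) unfolding limit_level_def index_set_def by (intro level_unbounded) simp_all
  then show ?thesis
  proof eventually_elim
    case (elim a)
    show ?case using stage_level_limit[of e F p'] stage_level_limit[of e F a]
    proof eventually_elim
      case (elim t)
      then show ?case
        unfolding rises_def using F(1) low_candidate_less(2)[OF F(1)] \<open>e \<le> p\<close>
          \<open>limit_level e F p' < limit_level e F a\<close> by auto
    qed
  qed
qed

lemma not_rises_limit_if_not_position:
  assumes "p \<notin> positions e"
  shows "\<forall>\<^sub>F p' in sequentially. \<forall>\<^sub>F a in sequentially. \<forall>\<^sub>F t in sequentially. \<not> rises e p p' a t"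
proof (cases "e \<le> p")
  case True
  let ?N = "2 ^ 2 ^ Suc p"
  have "\<forall>\<^sub>F p' in sequentially. low_candidate p F \<longrightarrow> (\<forall>a\<ge>p'. limit_level e F a = limit_level e F p')" for F
  proof (cases "low_candidate p F")
    case True
    then have "\<not> set_decode F \<subseteq> index_set e" using assms \<open>e \<le> p\<close> unfolding positions_def by blast
    then show ?thesis
      using level_eventually_const[of "set_decode F"] unfolding limit_level_def index_set_def by simp
  qed simp
  then have "\<forall>\<^sub>F p' in sequentially. \<forall>F\<in>{..<?N}. low_candidate p F \<longrightarrow>
      (\<forall>a\<ge>p'. limit_level e F a = limit_level e F p')"
    by (intro eventually_ball_finite ballI) (rule finite_lessThan)
  then show ?thesis
  proof eventually_elim
    case const: (elim p')
    show ?case using eventually_ge_at_top[of p']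
    proof eventually_elim
      case (elim a)
      show ?case using stage_level_limit_all[of ?N e a] stage_level_limit_all[of ?N e p']
      proof eventually_elim
        case (elim t)
        have "stage_level e F a t = stage_level e F p' t" if "F < ?N" "low_candidate p F" for F
        proof -
          have "F \<in> {..<?N}" using that(1) by (simp only: lessThan_iff)
          moreover from this have "limit_level e F a = limit_level e F p'"
            using const that(2) \<open>p' \<le> a\<close> by blast
          ultimately show ?thesis using elim by metis
        qed
        then show ?case unfolding rises_def by (metis less_irrefl)
      qed
    qed
  qed
qed (simp add: rises_def)

lemma rises_limit:
  "\<forall>\<^sub>F p' in sequentially. \<forall>\<^sub>F a in sequentially. \<forall>\<^sub>F t in sequentially.
     rises e p p' a t \<longleftrightarrow> p \<in> positions e"
  using rises_limit_if_position not_rises_limit_if_not_position by (cases "p \<in> positions e") simp_all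

definition first_elements :: "nat \<Rightarrow> nat set \<Rightarrow> nat set" where
  "first_elements n X = {p \<in> X. card {q \<in> X. q < p} < n}"

definition elected :: "nat \<Rightarrow> nat set" where
  "elected e = first_elements (2 ^ e) (positions e)"

lemma served_limit:
  assumes "p \<in> elected e" "\<And>e'. e' < e \<Longrightarrow> p \<notin> elected e'"
  shows "\<forall>\<^sub>F p' in sequentially. \<forall>\<^sub>F a in sequentially. \<forall>\<^sub>F t in sequentially. served p p' a t = e"
proof -
  have "\<forall>\<^sub>F p' in sequentially. \<forall>\<^sub>F a in sequentially. \<forall>\<^sub>F t in sequentially.
      \<forall>e'\<in>{..p}. \<forall>q\<in>{..p}. rises e' q p' a t \<longleftrightarrow> q \<in> positions e'"
    by (simp add: eventually_ball_finite_distrib rises_limit)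
  then show ?thesis
  proof (elim eventually_mono)
    fix p' a t
    assume rises: "\<forall>e'\<in>{..p}. \<forall>q\<in>{..p}. rises e' q p' a t \<longleftrightarrow> q \<in> positions e'"
    have "rises e' p p' a t \<and> card {q. q < p \<and> rises e' q p' a t} < 2 ^ e' \<longleftrightarrow> p \<in> elected e'"
      if "e' \<le> p" for e'
    proof -
      have "{q. q < p \<and> rises e' q p' a t} = {q \<in> positions e'. q < p}" using rises that by auto
      then show ?thesis using rises that by (simp add: elected_def first_elements_def)
    qed
    moreover have "e \<le> p" using assms(1) by (simp add: elected_def first_elements_def positions_def)
    ultimately show "served p p' a t = e"
      unfolding served_def using assms by (intro bounded_Least_eqI) auto
  qed
qed

lemma card_less_strict_mono_on:
  fixes X :: "nat set"
  shows "strict_mono_on X (\<lambda>p. card {q \<in> X. q < p})"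
proof (rule strict_mono_onI)
  fix p p' :: nat assume "p \<in> X" "p' \<in> X" "p < p'"
  then show "card {q \<in> X. q < p} < card {q \<in> X. q < p'}"
    by (intro psubset_card_mono) auto
qed

lemma first_elements_le:
  "finite (first_elements n X)" "card (first_elements n X) \<le> n"
proof -
  let ?rank = "\<lambda>p. card {q \<in> X. q < p}"
  have "inj_on ?rank X" using card_less_strict_mono_on by (rule strict_mono_on_imp_inj_on)
  then have inj: "inj_on ?rank (first_elements n X)"
    by (rule inj_on_subset) (auto simp: first_elements_def)
  have subset: "?rank ` first_elements n X \<subseteq> {..<n}" by (auto simp: first_elements_def)
  show "finite (first_elements n X)" using inj_on_finite[OF inj subset] by simp
  show "card (first_elements n X) \<le> n" using card_inj_on_le[OF inj subset] by simp
qed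

lemma card_first_elements:
  assumes "infinite X"
  shows "card (first_elements n X) = n"
proof (rule antisym)
  have "card {q \<in> X. q < enumerate X i} \<le> i" for i
  proof -
    have "{q \<in> X. q < enumerate X i} \<subseteq> enumerate X ` {..<i}"
    proof clarify
      fix q assume "q \<in> X" "q < enumerate X i"
      moreover from this obtain j where "q = enumerate X j" using enumerate_Ex[OF assms] by metis
      ultimately show "q \<in> enumerate X ` {..<i}" using assms by simp
    qed
    from surj_card_le[OF _ this] show ?thesis by simp
  qed
  then have "enumerate X ` {..<n} \<subseteq> first_elements n X"
    by (auto simp: first_elements_def enumerate_in_set[OF assms] intro: le_less_trans)
  from card_mono[OF first_elements_le(1) this]
  show "n \<le> card (first_elements n X)"
    using inj_enumerate[OF assms] by (simp add: card_image inj_on_subset)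
qed (rule first_elements_le(2))

lemma elected_exists:
  assumes "infinite (positions e)"
  obtains P where "P \<in> elected e" "\<And>e'. e' < e \<Longrightarrow> P \<notin> elected e'"
proof -
  have "card (\<Union>e'<e. elected e') \<le> (\<Sum>e'<e. card (elected e'))" by (rule card_UN_le) simp
  also have "\<dots> \<le> (\<Sum>e'<e. 2 ^ e')" unfolding elected_def by (intro sum_mono first_elements_le)
  also have "\<dots> < 2 ^ e" by (induction e) auto
  also have "\<dots> = card (elected e)" unfolding elected_def using assms by (simp add: card_first_elements)
  finally have "\<not> elected e \<subseteq> (\<Union>e'<e. elected e')"
    using card_mono[of "\<Union>e'<e. elected e'" "elected e"] first_elements_le(1)
    unfolding elected_def by (auto simp: not_less[symmetric])
  then show ?thesis using that by blast
qed

lemma highest_code_works: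
  assumes "F < N" "C F"
  shows "highest_code C N e a t < N" "C (highest_code C N e a t)"
    "stage_level e F a t \<le> stage_level e (highest_code C N e a t) a t"
proof -
  let ?best = "\<lambda>F. C F \<and> (\<forall>G<N. C G \<longrightarrow> stage_level e G a t \<le> stage_level e F a t)"
  obtain G where "G < N" "?best G"
    using ex_has_greatest_nat[of "\<lambda>F. F < N \<and> C F" F "\<lambda>F. stage_level e F a t" "Suc a"] assms
    by (auto simp: stage_level_def less_Suc_eq_le level_le)
  then have "?best (highest_code C N e a t)" "highest_code C N e a t < N"
    unfolding highest_code_def using bounded_LeastI[of ?best G N] bounded_Least_le[of ?best G N] by auto
  then show "highest_code C N e a t < N" "C (highest_code C N e a t)"
    "stage_level e F a t \<le> stage_level e (highest_code C N e a t) a t" using assms by blast+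
qed

lemma highest_code_limit:
  assumes "F < N" "C F" "set_decode F \<subseteq> index_set e"
  shows "\<forall>\<^sub>F a in sequentially. \<forall>\<^sub>F t in sequentially.
    C (highest_code C N e a t) \<and> set_decode (highest_code C N e a t) \<subseteq> index_set e"
proof -
  have "\<exists>K. \<forall>a. \<not> set_decode G \<subseteq> index_set e \<longrightarrow> limit_level e G a \<le> K" for G
    using level_bounded[of "set_decode G"] unfolding index_set_def limit_level_def by metis
  then obtain K where K: "\<And>G a. \<not> set_decode G \<subseteq> index_set e \<Longrightarrow> limit_level e G a \<le> K G" by metis
  have "\<forall>\<^sub>F a in sequentially. \<forall>G\<in>{..<N}. K G < limit_level e F a"
    using assms(3) unfolding limit_level_def index_set_def
    by (intro eventually_ball_finite ballI level_unbounded) simp_all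
  then show ?thesis
  proof eventually_elim
    case unbounded: (elim a)
    show ?case using stage_level_limit_all[of N e a]
    proof eventually_elim
      case (elim t)
      define G where "G = highest_code C N e a t"
      have G: "G < N" "C G" "stage_level e F a t \<le> stage_level e G a t"
        unfolding G_def using highest_code_works[of F N C] assms(1,2) by simp_all
      have "K G < limit_level e F a" using unbounded G(1) by simp
      also have "\<dots> \<le> limit_level e G a" using G(1,3) elim assms(1) by simp
      finally have "set_decode G \<subseteq> index_set e" using K by (meson not_less)
      with G(2) show ?case unfolding G_def by blast
    qed
  qed
qed

section \<open>No solution is a \<open>\<Pi>\<^sup>0\<^sub>3\<close> set\<close>

definition finite_sums :: "nat set \<Rightarrow> nat set" where
  "finite_sums H = {\<Sum>F | F. F \<subseteq> H \<and> finite F}"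

lemma finite_sumsI: "F \<subseteq> H \<Longrightarrow> finite F \<Longrightarrow> \<Sum>F \<in> finite_sums H"
  unfolding finite_sums_def by blast

lemma finite_sumsE:
  assumes "x \<in> finite_sums H"
  obtains F where "F \<subseteq> H" "finite F" "x = \<Sum>F"
  using assms unfolding finite_sums_def by blast

lemma FS_if_finite_sums: "x \<in> finite_sums H \<Longrightarrow> 0 < x \<Longrightarrow> x \<in> FS H"
  unfolding finite_sums_def FS_def by force

lemma zero_in_finite_sums: "0 \<in> finite_sums H"
  using finite_sumsI[of "{}" H] by simp

lemma finite_sums_mono: "B \<subseteq> C \<Longrightarrow> finite_sums B \<subseteq> finite_sums C"
  unfolding finite_sums_def by blast

lemma finite_sums_add:
  assumes "x \<in> finite_sums B" "y \<in> finite_sums C" "B \<inter> C = {}" "B \<union> C \<subseteq> H"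
  shows "x + y \<in> finite_sums H"
proof -
  obtain F where "F \<subseteq> B" "finite F" "x = \<Sum>F" using assms(1) by (rule finite_sumsE)
  moreover obtain G where "G \<subseteq> C" "finite G" "y = \<Sum>G" using assms(2) by (rule finite_sumsE)
  moreover from calculation have "\<Sum>(F \<union> G) = x + y"
    using assms(3) by (simp, intro sum.union_disjoint) auto
  ultimately show ?thesis using finite_sumsI[of "F \<union> G" H] assms(4) by auto
qed

lemma finite_sums_lessThan:
  assumes "x \<in> finite_sums B" "x < n"
  shows "x \<in> finite_sums (B \<inter> {..<n})"
proof -
  obtain F where F: "F \<subseteq> B" "finite F" "x = \<Sum>F" using assms(1) by (rule finite_sumsE)
  have "f < n" if "f \<in> F" for f
    using member_le_sum[of f F "\<lambda>f. f"] that F(2,3) assms(2) by simp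
  then show ?thesis unfolding F(3) using F(1,2) by (intro finite_sumsI) auto
qed

lemma divisible_finite_sum_exists:
  assumes "infinite A" "0 < d"
  obtains x where "x \<in> finite_sums (A \<inter> {N..})" "N \<le> x" "0 < x" "d dvd x"
proof -
  let ?B = "A - {..<Suc N}"
  have "infinite ?B" using assms(1) by simp
  moreover have "finite ((\<lambda>x. x mod d) ` ?B)"
    by (rule finite_subset[of _ "{..<d}"]) (use assms(2) in auto)
  ultimately obtain y where y: "infinite {x \<in> ?B. x mod d = y mod d}"
    using pigeonhole_infinite[of ?B "\<lambda>x. x mod d"] by blast
  obtain F where F: "F \<subseteq> {x \<in> ?B. x mod d = y mod d}" "finite F" "card F = d"
    using infinite_arbitrarily_large[OF y] by blast
  have "(\<Sum>x\<in>F. x mod d) = (\<Sum>x\<in>F. y mod d)" using F(1) by (intro sum.cong) auto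
  then have "\<Sum>F mod d = 0" using F(3) mod_sum_eq[of "\<lambda>x. x" d F] by simp
  then have "d dvd \<Sum>F" by (rule mod_0_imp_dvd)
  obtain f where "f \<in> F" using F(3) assms(2) by fastforce
  then have "N < \<Sum>F" using member_le_sum[of f F "\<lambda>f. f"] F(1,2) by auto
  with \<open>d dvd \<Sum>F\<close> show ?thesis using F(1,2) by (intro that[of "\<Sum>F"] finite_sumsI) auto
qed

lemma Pi03_index_exists:
  assumes "Pi03 A" "\<gamma> < 2"
  obtains e where "index_set e = A" "e mod 2 = \<gamma>"
proof -
  obtain R where R: "recursive_rel4 R" "\<And>n. n \<in> A \<longleftrightarrow> (\<forall>x. \<exists>y. \<forall>z. R n x y z)"
    using assms(1) unfolding Pi03_def by blast
  obtain e where "\<And>n x y. (\<forall>z. R n x y z) \<longleftrightarrow> (\<forall>t. unrefuted e n x y t)"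
    using recursive_rel4_unrefutedE[OF R(1)] by blast
  then have "index_set (2 * e + \<gamma>) = A" using R(2) assms(2) by (simp add: index_set_def set_eq_iff)
  moreover have "(2 * e + \<gamma>) mod 2 = \<gamma>" using assms(2) by simp
  ultimately show ?thesis by (rule that)
qed

lemma infinite_positions:
  assumes "infinite (index_set e)"
  shows "infinite (positions e)"
  unfolding infinite_nat_iff_unbounded_le
proof
  fix N
  obtain n where n: "2 ^ (N + e) \<le> n" "n \<in> index_set e"
    using assms unfolding infinite_nat_iff_unbounded_le by blast
  have singleton: "set_decode (set_encode {n}) = {n}" by (rule set_encode_inverse) simp
  have "N + e \<le> floor_log n" by (rule le_floor_log[OF n(1)])
  moreover have "0 < n" by (rule less_le_trans[OF _ n(1)]) simp
  then have "low_candidate (floor_log n) (set_encode {n})"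
    by (simp add: low_candidate_def code_sum_def singleton del: set_encode_insert)
  ultimately have "floor_log n \<in> positions e" using n(2) unfolding positions_def
    by (intro CollectI conjI exI[of _ "set_encode {n}"]) (simp_all add: singleton del: set_encode_insert)
  with \<open>N + e \<le> floor_log n\<close> show "\<exists>p\<ge>N. p \<in> positions e" by (meson add_leD1)
qed

lemma high_candidate_exists:
  assumes "infinite A"
  obtains p' F where "p\<^sub>0 \<le> p'" "p < p'" "high_candidate p p' F" "set_decode F \<subseteq> A"
proof -
  let ?N = "2 ^ (p\<^sub>0 + Suc p) :: nat"
  obtain x where x: "x \<in> finite_sums (A \<inter> {?N..})" "?N \<le> x" "0 < x" "2 ^ Suc p dvd x"
    using divisible_finite_sum_exists[OF assms, of "2 ^ Suc p" ?N] by auto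
  obtain G where G: "G \<subseteq> A \<inter> {?N..}" "finite G" "x = \<Sum>G" using x(1) by (rule finite_sumsE)
  have "2 ^ Suc p \<le> ?N" by (intro power_increasing) simp_all
  then have "\<forall>j\<in>G. 2 ^ Suc p \<le> j" using G(1) order_trans by blast
  then have "2 ^ 2 ^ Suc p dvd set_encode G"
    using G(2) by (simp add: power_dvd_iff_set_decode del: power_Suc)
  then have "high_candidate p (floor_log x) (set_encode G)"
    using x(3,4) G(2,3) by (simp add: high_candidate_def low_candidate_def code_sum_def del: power_Suc)
  moreover have "p\<^sub>0 + Suc p \<le> floor_log x" by (rule le_floor_log[OF x(2)])
  ultimately show ?thesis using G(1,2) by (intro that[of "floor_log x" "set_encode G"]) auto
qed

definition well_selected :: "nat \<Rightarrow> nat \<Rightarrow> nat \<Rightarrow> nat \<Rightarrow> nat \<Rightarrow> bool" where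
  "well_selected e p p' a t \<longleftrightarrow> served p p' a t = e \<and>
     low_candidate p (low_code p p' a t) \<and> set_decode (low_code p p' a t) \<subseteq> index_set e \<and>
     high_candidate p p' (high_code p p' a t) \<and> set_decode (high_code p p' a t) \<subseteq> index_set e"

lemma well_selected_limit:
  assumes "infinite (index_set e)"
  obtains p p' where "p < p'" "\<forall>\<^sub>F a in sequentially. \<forall>\<^sub>F t in sequentially. well_selected e p p' a t"
proof -
  obtain p where p: "p \<in> elected e" "\<And>e'. e' < e \<Longrightarrow> p \<notin> elected e'"
    using elected_exists[OF infinite_positions[OF assms]] by blast
  then obtain p\<^sub>0 where served: "\<And>p'. p\<^sub>0 \<le> p' \<Longrightarrow>
      \<forall>\<^sub>F a in sequentially. \<forall>\<^sub>F t in sequentially. served p p' a t = e"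
    using eventually_sequentiallyE[OF served_limit[OF p]] by blast
  obtain F where F: "low_candidate p F" "set_decode F \<subseteq> index_set e"
    using p(1) by (auto simp: elected_def first_elements_def positions_def)
  obtain p' F' where p': "p\<^sub>0 \<le> p'" "p < p'" and F': "high_candidate p p' F'" "set_decode F' \<subseteq> index_set e"
    using high_candidate_exists[OF assms] by blast
  have "F' < 2 ^ 2 ^ Suc p'" using F'(1) low_candidate_less(2) by (simp add: high_candidate_def)
  note high = highest_code_limit[where C = "high_candidate p p'", OF this F']
  note low = highest_code_limit[where C = "low_candidate p", OF low_candidate_less(2)[OF F(1)] F]
  have "\<forall>\<^sub>F a in sequentially. \<forall>\<^sub>F t in sequentially. well_selected e p p' a t"
    using served[OF p'(1)] low high
  proof eventually_elim
    case (elim a)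
    then show ?case by eventually_elim (simp add: well_selected_def low_code_def high_code_def)
  qed
  with p'(2) show ?thesis by (rule that)
qed

lemma finite_sums_above_exist:
  assumes "infinite A" "\<forall>\<^sub>F a in sequentially. \<forall>\<^sub>F t in sequentially. Q a t"
  obtains m k t where "m \<in> finite_sums (A \<inter> {2 ^ s..})" "0 < m" "2 ^ s dvd m"
    "k \<in> finite_sums (A \<inter> {2 ^ Suc (floor_log m)..})" "2 ^ Suc (floor_log m) dvd k"
    "t \<in> set_decode k" "2 ^ t dvd k" "Q (floor_log m) t"
proof -
  obtain a\<^sub>0 where a\<^sub>0: "\<And>a. a\<^sub>0 \<le> a \<Longrightarrow> \<forall>\<^sub>F t in sequentially. Q a t"
    using eventually_sequentiallyE[OF assms(2)] by blast
  obtain m where m: "m \<in> finite_sums (A \<inter> {2 ^ (s + a\<^sub>0)..})" "2 ^ (s + a\<^sub>0) \<le> m" "0 < m" "2 ^ s dvd m"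
    using divisible_finite_sum_exists[OF assms(1), of "2 ^ s" "2 ^ (s + a\<^sub>0)"] by auto
  let ?a = "floor_log m"
  have "a\<^sub>0 \<le> ?a" using le_floor_log[OF m(2)] by simp
  then obtain t\<^sub>0 where t\<^sub>0: "\<And>t. t\<^sub>0 \<le> t \<Longrightarrow> Q ?a t"
    using eventually_sequentiallyE[OF a\<^sub>0] by blast
  obtain k where k: "k \<in> finite_sums (A \<inter> {2 ^ Suc ?a..})" "0 < k" "2 ^ (Suc ?a + t\<^sub>0) dvd k"
    using divisible_finite_sum_exists[OF assms(1), of "2 ^ (Suc ?a + t\<^sub>0)" "2 ^ Suc ?a"] by auto
  obtain t where t: "t \<in> set_decode k" "2 ^ t dvd k" using lowest_bit_exists[OF k(2)] .
  have "A \<inter> {2 ^ (s + a\<^sub>0)..} \<subseteq> A \<inter> {2 ^ s..}"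
    using order_trans[of "2 ^ s" "2 ^ (s + a\<^sub>0) :: nat"] by auto
  then have "m \<in> finite_sums (A \<inter> {2 ^ s..})" using m(1) finite_sums_mono by blast
  moreover have "2 ^ Suc ?a dvd k" using k(3) by (rule power_le_dvd) simp
  moreover have "Q ?a t" using t\<^sub>0 set_decode_ge[OF k(3) t(1)] by simp
  ultimately show ?thesis using that m(3,4) k(1) t by blast
qed

lemma finite_sums_add_blocks:
  assumes "m \<in> finite_sums (A \<inter> {..<u})" "m' \<in> finite_sums (A \<inter> {u..<v})"
    "m'' \<in> finite_sums (A \<inter> {v..<w})" "k \<in> finite_sums (A \<inter> {w..})" "u \<le> v" "v \<le> w"
  shows "m + m' + m'' + k \<in> finite_sums A"
proof -
  have "m + m' \<in> finite_sums (A \<inter> {..<v})"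
    using assms(1,2) by (rule finite_sums_add) (use assms(5) in auto)
  then have "m + m' + m'' \<in> finite_sums (A \<inter> {..<w})"
    using assms(3) by (rule finite_sums_add) (use assms(6) in auto)
  then show ?thesis using assms(4) by (rule finite_sums_add) auto
qed

lemma even_defect_if_monochromatic:
  assumes monochromatic: "\<And>x. x \<in> FS A \<Longrightarrow> table_coloring D x = \<gamma>"
    and m: "m \<in> finite_sums A" "0 < m"
    and m': "m' \<in> finite_sums (A \<inter> {2 ^ Suc (floor_log m)..})" "0 < m'" "2 ^ Suc (floor_log m) dvd m'"
    and m'': "m'' \<in> finite_sums (A \<inter> {2 ^ Suc (floor_log m')..})" "0 < m''"
      "2 ^ Suc (floor_log m') dvd m''"
    and k: "k \<in> finite_sums (A \<inter> {2 ^ Suc (floor_log m'')..})" "2 ^ Suc (floor_log m'') dvd k"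
    and "\<tau> \<in> set_decode k" "2 ^ \<tau> dvd k"
  shows "even (\<gamma> + defect (D \<tau>) (floor_log m'') m m')"
proof (rule even_defect_if_cube_monochromatic)
  show "stacked m m'" using m'(3) by (rule stackedI_floor_log)
  then have "floor_log (m + m') = floor_log m'" using m'(2) by (rule floor_log_add_stacked)
  then show "stacked (m + m') m''" using m''(3) by (simp add: stackedI_floor_log)
  then have "floor_log (m + m' + m'') = floor_log m''" using m''(2) by (rule floor_log_add_stacked)
  then show "stacked (m + m' + m'') k" using k(2) by (simp add: stackedI_floor_log)
next
  fix i j l h assume vertex: "i \<in> {0, m}" "j \<in> {0, m'}" "l \<in> {0, m''}" "h \<in> {0, k}"
    and "0 < i + j + l + h"
  let ?u = "2 ^ Suc (floor_log m) :: nat" and ?v = "2 ^ Suc (floor_log m') :: nat"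
    and ?w = "2 ^ Suc (floor_log m'') :: nat"
  have "?u \<le> ?v" "?v \<le> ?w"
    using less_floor_log_if_power_dvd[OF m'(3,2)] less_floor_log_if_power_dvd[OF m''(3,2)] by simp_all
  moreover have "m \<in> finite_sums (A \<inter> {..<?u})" "m' \<in> finite_sums (A \<inter> {?u..<?v})"
    "m'' \<in> finite_sums (A \<inter> {?v..<?w})"
    using m(1) m'(1) m''(1) less_exp_Suc_floor_log
    by (simp_all only: finite_sums_lessThan atLeastLessThan_def flip: Int_assoc)
  ultimately have "i + j + l + h \<in> finite_sums A"
    using vertex k(1) zero_in_finite_sums by (intro finite_sums_add_blocks[of i A ?u j ?v l ?w h]) blast+
  then show "table_coloring D (i + j + l + h) = \<gamma>"
    using \<open>0 < i + j + l + h\<close> by (intro monochromatic FS_if_finite_sums)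
qed fact+

lemma finite_sums_well_selected:
  assumes "well_selected e p p' a t"
  shows "code_sum (low_code p p' a t) \<in> finite_sums (index_set e)"
    "code_sum (high_code p p' a t) \<in> finite_sums (index_set e \<inter> {2 ^ Suc p..})"
proof -
  show "code_sum (low_code p p' a t) \<in> finite_sums (index_set e)"
    using assms unfolding well_selected_def code_sum_def by (intro finite_sumsI) simp_all
  have "2 ^ 2 ^ Suc p dvd high_code p p' a t" "set_decode (high_code p p' a t) \<subseteq> index_set e"
    using assms by (simp_all add: well_selected_def high_candidate_def)
  then show "code_sum (high_code p p' a t) \<in> finite_sums (index_set e \<inter> {2 ^ Suc p..})"
    unfolding code_sum_def power_dvd_iff_set_decode by (intro finite_sumsI) auto
qed

lemma not_monochromatic_if_index_set:
  assumes "infinite (index_set e)" "\<And>x. x \<in> FS (index_set e) \<Longrightarrow> coloring x = e mod 2"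
  shows False
proof -
  obtain p p' where "p < p'"
    and limit: "\<forall>\<^sub>F a in sequentially. \<forall>\<^sub>F t in sequentially. well_selected e p p' a t"
    using well_selected_limit[OF assms(1)] .
  obtain m'' k t
    where m'': "m'' \<in> finite_sums (index_set e \<inter> {2 ^ Suc p'..})" "0 < m''" "2 ^ Suc p' dvd m''"
    and k: "k \<in> finite_sums (index_set e \<inter> {2 ^ Suc (floor_log m'')..})" "2 ^ Suc (floor_log m'') dvd k"
    and t: "t \<in> set_decode k" "2 ^ t dvd k" and selected: "well_selected e p p' (floor_log m'') t"
    using finite_sums_above_exist[OF assms(1) limit] .
  let ?a = "floor_log m''"
  define m where "m = code_sum (low_code p p' ?a t)"
  define m' where "m' = code_sum (high_code p p' ?a t)"
  have m: "0 < m" "floor_log m = p" and m': "0 < m'" "floor_log m' = p'" "2 ^ Suc p dvd m'"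
    using selected
    by (simp_all add: well_selected_def low_candidate_def high_candidate_def m_def m'_def)
  have "p' < ?a" using m''(3,2) by (rule less_floor_log_if_power_dvd)
  moreover have "?a < t" using set_decode_ge[OF k(2) t(1)] by simp
  ultimately have "odd (e + defect (coefficient t) ?a m m')"
    using odd_defect_coefficient[OF \<open>p < p'\<close>, of ?a t] selected
    by (simp add: well_selected_def m_def m'_def)
  moreover have "even (e mod 2 + defect (coefficient t) ?a m m')"
    using assms(2) finite_sums_well_selected[OF selected] m m' m'' k t
    by (intro even_defect_if_monochromatic[where A = "index_set e" and k = k])
      (simp_all only: coloring_def m_def m'_def)
  ultimately show False by presburger
qed

theorem theorem4p3:
  shows "\<exists>c. recursive1 c \<and> (\<forall>n. c n < 8) \<and>
           (\<forall>A. infinite A \<and> Pi03 A \<longrightarrow> \<not> hindman_solution c A)"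
proof (intro exI[of _ coloring] conjI allI impI notI)
  show "recursive1 coloring" by (rule recursive1_coloring)
  have coloring_less: "coloring n < 2" for n by (simp add: coloring_def table_coloring_def)
  then show "coloring n < 8" for n using less_trans[of "coloring n" 2 8] by simp
  fix A assume A: "infinite A \<and> Pi03 A" and "hindman_solution coloring A"
  then obtain \<gamma> where \<gamma>: "\<And>x. x \<in> FS A \<Longrightarrow> coloring x = \<gamma>" unfolding hindman_solution_def by blast
  obtain n where "n \<in> A" using A by (metis finite.emptyI ex_in_conv)
  then have "n \<in> FS A" by (auto simp: FS_def intro!: exI[of _ "{n}"])
  then have "\<gamma> < 2" using \<gamma> coloring_less by metis
  then obtain e where "index_set e = A" "e mod 2 = \<gamma>" using A Pi03_index_exists by blast
  then show False using not_monochromatic_if_index_set[of e] A \<gamma> by blast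
qed

end
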